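(* Let $E$ be a real or complex Banach space and let $\mathcal{F}=((a_n,b_n^* ))_{n\in\mathbb{N}^*}\subset E\times E^*$ be a Besselian Schauder frame for $E$. Then: 1. $\mathcal{F}$ is shrinking if and only if there is no subspace of $E$ isomorphic to $\ell_1$. 2. The following three conditions are equivalent: $\mathcal{F}$ is boundedly complete; $E$ is weakly sequentially complete; there is no subspace of $E$ isomorphic to $c_0$. 3. $E$ is reflexive if and only if $E$ contains no isomorphic copy of $\ell_1$ and no isomorphic copy of $c_0$.
   Context: $\mathbb{N}^*=\{1,2,3,\dots\}$; $E^*$ is the topological dual of $E$, and $J_E:E\to E^{**}$ is the canonical embedding. A sequence $((a_n,b_n^* ))_{n\in\mathbb{N}^*}$ in $E\times E^*$ is a Schauder frame for $E$ if for every $x\in E$ the series $\sum_n b_n^*(x)a_n$ converges in norm to $x$. It is Besselian if there is a constant $B>0$ with $\sum_{n=1}^\infty |b_n^*(x)||y^*(a_n)|\le B\|x\|_E\|y^*\|_{E^*}$ for all $x\in E$, $y^*\in E^*$. A Besselian Schauder frame is a Schauder frame that is Besselian. A Schauder frame $\mathcal{F}=((a_n,b_n^* ))_n$ for $E$ is called shrinking if its dual sequence $\mathcal{F}^*=((b_n^*,J_E(a_n)))_n\subset E^*\times E^{**}$ is a Schauder frame for $E^*$. It is called boundedly complete if for every $x^{**}\in E^{**}$ the series $\sum_n x^{**}(b_n^* )a_n$ converges in $E$. $E$ is weakly sequentially complete if every weakly Cauchy sequence in $E$ (i.e. $(x_n)$ such that $\lim_n y^*(x_n)$ exists for every $y^*\in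 E^*$) converges weakly to an element of $E$. *)

theory Defs
  imports "HOL-Analysis.Analysis"
begin

(* The scalar field is either the reals or the complex numbers, each with its usual absolute
   value.  The element of_real r is written as r times 1 since of_real is not available inside
   a class specification. *)
class real_or_complex = real_normed_field +
  assumes real_or_complex_cases:
    "(\<forall>z. \<exists>r. z = r *\<^sub>R 1) \<or>
     (\<exists>j. j * j = - 1 \<and> (\<forall>z. \<exists>r s. z = r *\<^sub>R 1 + s *\<^sub>R j) \<and>
          (\<forall>r s. norm (r *\<^sub>R 1 + s *\<^sub>R j) = sqrt (r\<^sup>2 + s\<^sup>2)))"

instance real :: real_or_complex
  by standard simp

instance complex :: real_or_complex
proof
  have "\<exists>r s. z = r *\<^sub>R 1 + s *\<^sub>R \<i>" for z :: complex
    by (intro exI[of _ "Re z"] exI[of _ "Im z"]) (simp add: complex_eq_iff)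
  then show "(\<forall>z::complex. \<exists>r. z = r *\<^sub>R 1) \<or>
     (\<exists>j::complex. j * j = - 1 \<and> (\<forall>z. \<exists>r s. z = r *\<^sub>R 1 + s *\<^sub>R j) \<and>
          (\<forall>r s. norm (r *\<^sub>R 1 + s *\<^sub>R j) = sqrt (r\<^sup>2 + s\<^sup>2)))"
    by (intro disjI2 exI[of _ \<i>]) (auto simp: cmod_def)
qed

(* A normed space over 'k is a real normed space whose real structure is the restriction of
   the given scalar multiplication sc. *)
locale normed_space_over = vector_space sc
  for sc :: "'k::real_or_complex \<Rightarrow> 'v::real_normed_vector \<Rightarrow> 'v" +
  assumes norm_sc: "norm (sc c x) = norm c * norm x"
    and sc_of_real: "sc (of_real r) x = r *\<^sub>R x"

lemma normed_space_over_scaleR: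
  "normed_space_over (scaleR :: real \<Rightarrow> 'v::real_normed_vector \<Rightarrow> 'v)"
  by unfold_locales (simp_all add: algebra_simps)

lemma normed_space_over_mult:
  "normed_space_over ((*) :: 'k::real_or_complex \<Rightarrow> 'k \<Rightarrow> 'k)"
  by unfold_locales (simp_all add: algebra_simps norm_mult scaleR_conv_of_real)

(* The continuous 'k-linear functionals on a linear subspace V; values off V are irrelevant. *)
definition continuous_functionals ::
    "('k::real_or_complex \<Rightarrow> 'v::real_normed_vector \<Rightarrow> 'v) \<Rightarrow> 'v set \<Rightarrow> ('v \<Rightarrow> 'k) set" where
  "continuous_functionals sc V =
     {f. (\<forall>x\<in>V. \<forall>y\<in>V. f (x + y) = f x + f y) \<and>
         (\<forall>c. \<forall>x\<in>V. f (sc c x) = c * f x) \<and>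
         (\<exists>B. \<forall>x\<in>V. norm (f x) \<le> B * norm x)}"

(* The dual of the whole space.  Elements of the blinfun type are only real-linear, so over
   the complex numbers this is a proper subset; its norm is the operator norm of blinfun.
   The bidual is continuous_functionals dual_scale (dual_space sc). *)
definition dual_space ::
    "('k::real_or_complex \<Rightarrow> 'e::real_normed_vector \<Rightarrow> 'e) \<Rightarrow> ('e \<Rightarrow>\<^sub>L 'k) set" where
  "dual_space sc = {f. blinfun_apply f \<in> continuous_functionals sc UNIV}"

definition dual_scale ::
    "'k::real_or_complex \<Rightarrow> ('e::real_normed_vector \<Rightarrow>\<^sub>L 'k) \<Rightarrow> ('e \<Rightarrow>\<^sub>L 'k)" where
  "dual_scale c f = blinfun_mult_right c o\<^sub>L f"

lemma blinfun_apply_dual_scale [simp]: "blinfun_apply (dual_scale c f) x = c * blinfun_apply f x"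
  by (simp add: dual_scale_def)

lemma dual_space_iff:
  "f \<in> dual_space sc \<longleftrightarrow> (\<forall>c x. blinfun_apply f (sc c x) = c * blinfun_apply f x)"
proof -
  have "\<exists>B. \<forall>x. norm (blinfun_apply f x) \<le> B * norm x"
    by (intro exI[of _ "norm f"] allI norm_blinfun)
  then show ?thesis
    by (simp add: dual_space_def continuous_functionals_def blinfun.add_right)
qed

definition canonical_embedding :: "'e::real_normed_vector \<Rightarrow> ('e \<Rightarrow>\<^sub>L 'k) \<Rightarrow> 'k::real_or_complex" where
  "canonical_embedding x = (\<lambda>f. blinfun_apply f x)"

(* Stated relative to a subspace V so that it applies both to E and to its dual.  Sequences
   are indexed from 0. *)
definition schauder_frame ::
    "('k::real_or_complex \<Rightarrow> 'v::real_normed_vector \<Rightarrow> 'v) \<Rightarrow> 'v set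
      \<Rightarrow> (nat \<Rightarrow> 'v) \<Rightarrow> (nat \<Rightarrow> 'v \<Rightarrow> 'k) \<Rightarrow> bool" where
  "schauder_frame sc V a b \<longleftrightarrow>
     range a \<subseteq> V \<and> range b \<subseteq> continuous_functionals sc V \<and>
     (\<forall>x\<in>V. (\<lambda>n. sc (b n x) (a n)) sums x)"

definition besselian ::
    "('k::real_or_complex \<Rightarrow> 'e::real_normed_vector \<Rightarrow> 'e)
      \<Rightarrow> (nat \<Rightarrow> 'e) \<Rightarrow> (nat \<Rightarrow> 'e \<Rightarrow>\<^sub>L 'k) \<Rightarrow> bool" where
  "besselian sc a b \<longleftrightarrow>
     (\<exists>B>0. \<forall>x. \<forall>y\<in>dual_space sc.
        summable (\<lambda>n. norm (blinfun_apply (b n) x) * norm (blinfun_apply y (a n))) \<and>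
        (\<Sum>n. norm (blinfun_apply (b n) x) * norm (blinfun_apply y (a n))) \<le> B * norm x * norm y)"

definition besselian_schauder_frame ::
    "('k::real_or_complex \<Rightarrow> 'e::real_normed_vector \<Rightarrow> 'e)
      \<Rightarrow> (nat \<Rightarrow> 'e) \<Rightarrow> (nat \<Rightarrow> 'e \<Rightarrow>\<^sub>L 'k) \<Rightarrow> bool" where
  "besselian_schauder_frame sc a b \<longleftrightarrow>
     schauder_frame sc UNIV a (\<lambda>n. blinfun_apply (b n)) \<and> besselian sc a b"

definition shrinking ::
    "('k::real_or_complex \<Rightarrow> 'e::real_normed_vector \<Rightarrow> 'e)
      \<Rightarrow> (nat \<Rightarrow> 'e) \<Rightarrow> (nat \<Rightarrow> 'e \<Rightarrow>\<^sub>L 'k) \<Rightarrow> bool" where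
  "shrinking sc a b \<longleftrightarrow>
     schauder_frame dual_scale (dual_space sc) b (\<lambda>n. canonical_embedding (a n))"

definition boundedly_complete ::
    "('k::real_or_complex \<Rightarrow> 'e::real_normed_vector \<Rightarrow> 'e)
      \<Rightarrow> (nat \<Rightarrow> 'e) \<Rightarrow> (nat \<Rightarrow> 'e \<Rightarrow>\<^sub>L 'k) \<Rightarrow> bool" where
  "boundedly_complete sc a b \<longleftrightarrow>
     (\<forall>\<phi>\<in>continuous_functionals dual_scale (dual_space sc). summable (\<lambda>n. sc (\<phi> (b n)) (a n)))"

definition weakly_sequentially_complete ::
    "('k::real_or_complex \<Rightarrow> 'e::real_normed_vector \<Rightarrow> 'e) \<Rightarrow> bool" where
  "weakly_sequentially_complete sc \<longleftrightarrow>
     (\<forall>x :: nat \<Rightarrow> 'e.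
        (\<forall>y\<in>dual_space sc. convergent (\<lambda>n. blinfun_apply y (x n))) \<longrightarrow>
        (\<exists>l. \<forall>y\<in>dual_space sc. (\<lambda>n. blinfun_apply y (x n)) \<longlonglongrightarrow> blinfun_apply y l))"

definition reflexive_space ::
    "('k::real_or_complex \<Rightarrow> 'e::real_normed_vector \<Rightarrow> 'e) \<Rightarrow> bool" where
  "reflexive_space sc \<longleftrightarrow>
     (\<forall>\<phi>\<in>continuous_functionals dual_scale (dual_space sc).
        \<exists>x. \<forall>f\<in>dual_space sc. \<phi> f = canonical_embedding x f)"

definition l1_space :: "(nat \<Rightarrow> 'k::real_or_complex) set" where
  "l1_space = {s. summable (\<lambda>n. norm (s n))}"

definition l1_norm :: "(nat \<Rightarrow> 'k::real_or_complex) \<Rightarrow> real" where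
  "l1_norm s = (\<Sum>n. norm (s n))"

definition c0_space :: "(nat \<Rightarrow> 'k::real_or_complex) set" where
  "c0_space = {s. s \<longlonglongrightarrow> 0}"

definition sup_norm :: "(nat \<Rightarrow> 'k::real_or_complex) \<Rightarrow> real" where
  "sup_norm s = (SUP n. norm (s n))"

(* Some linear subspace M is the image of the sequence space X, normed by N, under a linear
   bijection that is bounded together with its inverse. *)
definition has_subspace_isomorphic_to ::
    "('k::real_or_complex \<Rightarrow> 'e::real_normed_vector \<Rightarrow> 'e)
      \<Rightarrow> (nat \<Rightarrow> 'k) set \<Rightarrow> ((nat \<Rightarrow> 'k) \<Rightarrow> real) \<Rightarrow> bool" where
  "has_subspace_isomorphic_to sc X N \<longleftrightarrow>
     (\<exists>M T. module.subspace sc M \<and> bij_betw T X M \<and>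
        (\<forall>s\<in>X. \<forall>t\<in>X. T (\<lambda>n. s n + t n) = T s + T t) \<and>
        (\<forall>c. \<forall>s\<in>X. T (\<lambda>n. c * s n) = sc c (T s)) \<and>
        (\<exists>C. \<forall>s\<in>X. norm (T s) \<le> C * N s) \<and>
        (\<exists>D. \<forall>s\<in>X. N s \<le> D * norm (T s)))"

end

theory Submission
  imports Defs "HOL-Complex_Analysis.Great_Picard"
begin

text \<open>The Besselian condition makes every series \<open>\<Sum>y(a\<^sub>n) b\<^sub>n\<close> in the dual, and every series
  \<open>\<Sum>\<phi>(b\<^sub>n) a\<^sub>n\<close> with \<open>\<phi>\<close> in the bidual, weakly unconditionally Cauchy.  If such a series diverges,
  it has disjoint blocks that are bounded away from 0, and Rosenthal's lemma selects blocks that are almost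
  biorthogonal to suitable test vectors or functionals.  In the first case the test vectors span a
  copy of \<open>\<ell>\<^sub>1\<close>, in the second the blocks span a copy of \<open>c\<^sub>0\<close>.  The same selection shows that the
  limit of a weakly Cauchy sequence is given by the frame expansion.  Conversely, a copy of \<open>\<ell>\<^sub>1\<close>
  contains a bounded sequence without weakly Cauchy subsequences, and a copy of \<open>c\<^sub>0\<close> contains a
  weakly Cauchy sequence without a weak limit.\<close>

subsection \<open>The scalar field\<close>

text \<open>The Besselian condition provides only upper bounds, on sums of absolute values of
  scalars. An isomorphic copy of a sequence space also needs a lower estimate, and a frame offers no
  biorthogonality from which to read one off, since its expansions need not be unique. Rosenthal's
  lemma replaces biorthogonality by diagonal dominance: the diagonal terms are at least
  \<open>\<delta>\<close>, the off-diagonal sums at most \<open>\<delta> / 2\<close>. The resulting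
  error is a fixed fraction of the very norm that is to be estimated, so it can be absorbed on the
  other side. A second concern is the scalar field. Elements of the type of bounded linear maps are
  only real-linear, so in the complex case \<open>dual_space sc\<close> is a proper subset of that
  type. Hahn--Banach is therefore developed for the scalar multiplication \<open>sc\<close>, and
  each functional that is constructed is also shown to lie in \<open>dual_space sc\<close>.\<close>

instance real_or_complex \<subseteq> heine_borel
proof
  fix f :: "nat \<Rightarrow> 'a::real_or_complex"
  assume "bounded (range f)"
  then obtain K where K: "norm (f n) \<le> K" for n
    by (auto simp: bounded_iff)
  consider "\<forall>z::'a. \<exists>r. z = r *\<^sub>R 1"
    | j :: 'a where "\<forall>z. \<exists>r s. z = r *\<^sub>R 1 + s *\<^sub>R j"
        "\<forall>r s. norm (r *\<^sub>R 1 + s *\<^sub>R j) = sqrt (r\<^sup>2 + s\<^sup>2)"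
    using real_or_complex_cases[where 'a = 'a] by blast
  then show "\<exists>l r. strict_mono (r::nat \<Rightarrow> nat) \<and> (f \<circ> r) \<longlonglongrightarrow> l"
  proof cases
    case 1
    then have "\<forall>n. \<exists>r. f n = r *\<^sub>R 1"
      by blast
    then obtain g where g: "\<And>n. f n = g n *\<^sub>R 1"
      by (auto dest!: choice)
    have "bounded (range g)"
      using K by (auto simp: bounded_iff g)
    then obtain l r where r: "strict_mono (r::nat \<Rightarrow> nat)" "(g \<circ> r) \<longlonglongrightarrow> l"
      using bounded_imp_convergent_subsequence by blast
    from r(2) have "(\<lambda>n. g (r n) *\<^sub>R (1::'a)) \<longlonglongrightarrow> l *\<^sub>R 1"
      unfolding o_def by (intro tendsto_intros)
    with r(1) show ?thesis
      by (auto simp: o_def g)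
  next
    case 2
    then have "\<forall>n. \<exists>r s. f n = r *\<^sub>R 1 + s *\<^sub>R j"
      by blast
    then obtain g h where gh: "\<And>n. f n = g n *\<^sub>R 1 + h n *\<^sub>R j"
      by (auto dest!: choice)
    \<comment> \<open>The modulus formula identifies scalars isometrically with points of the
      Euclidean plane, where bounded sequences have convergent subsequences.\<close>
    have "norm (g n, h n) \<le> K" for n
      using K[of n] 2(2) by (simp add: gh norm_Pair)
    then have "bounded (range (\<lambda>n. (g n, h n)))"
      by (auto simp: bounded_iff)
    then obtain l r where r: "strict_mono (r::nat \<Rightarrow> nat)" "((\<lambda>n. (g n, h n)) \<circ> r) \<longlonglongrightarrow> l"
      using bounded_imp_convergent_subsequence by blast
    from tendsto_fst[OF r(2)] tendsto_snd[OF r(2)]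
    have "(\<lambda>n. g (r n) *\<^sub>R 1 + h (r n) *\<^sub>R j) \<longlonglongrightarrow> fst l *\<^sub>R 1 + snd l *\<^sub>R j"
      unfolding o_def by (intro tendsto_intros) simp_all
    with r(1) show ?thesis
      by (auto simp: o_def gh)
  qed
qed

text \<open>Heine--Borel implies completeness. Complete scalars make
  \<open>'e \<Rightarrow>\<^sub>L 'k\<close> a Banach space, so the convergence criteria for series
  apply to series of functionals as well.\<close>

instance real_or_complex \<subseteq> banach ..

lemma real_or_complex_phase:
  fixes z :: "'k::real_or_complex"
  obtains u :: 'k where "norm u = 1" "u * z = of_real (norm z)"
proof (cases "z = 0")
  case True
  then show ?thesis
    using that[of 1] by simp
next
  case False
  then show ?thesis
    using that[of "of_real (norm z) / z"] by (simp add: norm_divide)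
qed

text \<open>Unimodular factors turn a sum of absolute values into the value of a single linear
  functional at a single vector, which a norm bound then controls.\<close>

lemma real_or_complex_phases:
  fixes f :: "'i \<Rightarrow> 'k::real_or_complex"
  obtains u :: "'i \<Rightarrow> 'k" where "\<And>i. norm (u i) = 1" "\<And>i. u i * f i = of_real (norm (f i))"
proof -
  have "\<forall>i. \<exists>u. norm u = 1 \<and> u * f i = of_real (norm (f i))"
    using real_or_complex_phase by blast
  then show ?thesis
    using that by (auto dest!: choice)
qed

subsection \<open>The Hahn--Banach theorem\<close>

text \<open>Only one half of positive homogeneity is demanded; using it for \<open>r\<close> and for
  \<open>inverse r\<close> gives equality. This shortens the check for functionals defined as
  infima.\<close>

definition sublinear :: "('v::real_vector \<Rightarrow> real) \<Rightarrow> bool" where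
  "sublinear p \<longleftrightarrow> (\<forall>x y. p (x + y) \<le> p x + p y) \<and> (\<forall>r>0. \<forall>x. p (r *\<^sub>R x) \<le> r * p x)"

lemma sublinearI:
  assumes "\<And>x y. p (x + y) \<le> p x + p y" "\<And>r x. r > 0 \<Longrightarrow> p (r *\<^sub>R x) \<le> r * p x"
  shows "sublinear p"
  using assms by (simp add: sublinear_def)

lemma sublinear_add: "sublinear p \<Longrightarrow> p (x + y) \<le> p x + p y"
  by (simp add: sublinear_def)

lemma sublinear_scaleR_le: "sublinear p \<Longrightarrow> r > 0 \<Longrightarrow> p (r *\<^sub>R x) \<le> r * p x"
  by (simp add: sublinear_def)

lemma sublinear_0: "sublinear p \<Longrightarrow> p 0 = 0"
  using sublinear_scaleR_le[of p 2 0] sublinear_scaleR_le[of p "1/2" 0] by simp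

lemma sublinear_scaleR:
  assumes "sublinear p" "r \<ge> 0"
  shows "p (r *\<^sub>R x) = r * p x"
proof (cases "r = 0")
  case True
  then show ?thesis
    using assms by (simp add: sublinear_0)
next
  case False
  with assms have r: "r > 0"
    by simp
  have "p (inverse r *\<^sub>R r *\<^sub>R x) \<le> inverse r * p (r *\<^sub>R x)"
    using assms r by (intro sublinear_scaleR_le) auto
  then have "r * p x \<le> p (r *\<^sub>R x)"
    using r by (simp add: field_simps)
  then show ?thesis
    using sublinear_scaleR_le[OF assms(1) r, of x] by linarith
qed

lemma sublinear_minus: "sublinear p \<Longrightarrow> - p (- x) \<le> p x"
  using sublinear_add[of p x "- x"] by (simp add: sublinear_0)

text \<open>This is the largest sublinear functional \<open>q\<close> below \<open>p\<close> with
  \<open>q (- y) \<le> - p y\<close>: any such \<open>q\<close> satisfies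
  \<open>q x \<le> q (x + t *\<^sub>R y) + t * q (- y)\<close> for \<open>t \<ge> 0\<close>.\<close>

definition sublinear_shift :: "('v::real_vector \<Rightarrow> real) \<Rightarrow> 'v \<Rightarrow> 'v \<Rightarrow> real" where
  "sublinear_shift p y x = (INF t\<in>{0..}. p (x + t *\<^sub>R y) - t * p y)"

lemma sublinear_shift_le:
  assumes "sublinear p" "t \<ge> 0"
  shows "sublinear_shift p y x \<le> p (x + t *\<^sub>R y) - t * p y"
  unfolding sublinear_shift_def
proof (rule cINF_lower)
  show "bdd_below ((\<lambda>t. p (x + t *\<^sub>R y) - t * p y) ` {0..})"
  proof (rule bdd_belowI2)
    fix t :: real assume "t \<in> {0..}"
    then have "t * p y \<le> p (x + t *\<^sub>R y) + p (- x)"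
      using sublinear_add[OF assms(1), of "x + t *\<^sub>R y" "- x"]
        sublinear_scaleR[OF assms(1), of t y] by simp
    then show "- p (- x) \<le> p (x + t *\<^sub>R y) - t * p y"
      by simp
  qed
qed (use assms in simp)

lemma sublinear_shift_ge:
  assumes "\<And>t. t \<ge> 0 \<Longrightarrow> c \<le> p (x + t *\<^sub>R y) - t * p y"
  shows "c \<le> sublinear_shift p y x"
  unfolding sublinear_shift_def by (rule cINF_greatest) (use assms in auto)

lemma sublinear_shift_minus:
  assumes "sublinear p"
  shows "sublinear_shift p y (- y) \<le> - p y"
  using sublinear_shift_le[OF assms, of 1 y "- y"] by (simp add: sublinear_0[OF assms])

lemma sublinear_sublinear_shift:
  assumes "sublinear p"
  shows "sublinear (sublinear_shift p y)"
proof (rule sublinearI)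
  fix x x'
  have *: "sublinear_shift p y (x + x') - (p (x' + t *\<^sub>R y) - t * p y) \<le> p (x + s *\<^sub>R y) - s * p y"
    if "s \<ge> 0" "t \<ge> 0" for s t
    using sublinear_shift_le[OF assms, of "s + t" y "x + x'"] that
      sublinear_add[OF assms, of "x + s *\<^sub>R y" "x' + t *\<^sub>R y"]
    by (simp add: algebra_simps)
  have "sublinear_shift p y (x + x') - sublinear_shift p y x \<le> p (x' + t *\<^sub>R y) - t * p y"
    if "t \<ge> 0" for t
    using sublinear_shift_ge[OF *, of t] that by (simp add: algebra_simps)
  from sublinear_shift_ge[OF this]
  show "sublinear_shift p y (x + x') \<le> sublinear_shift p y x + sublinear_shift p y x'"
    by (simp add: algebra_simps)
next
  fix r :: real and x assume r: "r > 0"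
  have "sublinear_shift p y (r *\<^sub>R x) / r \<le> p (x + t *\<^sub>R y) - t * p y" if "t \<ge> 0" for t
  proof -
    have "sublinear_shift p y (r *\<^sub>R x) \<le> p (r *\<^sub>R (x + t *\<^sub>R y)) - (r * t) * p y"
      using sublinear_shift_le[OF assms, of "r * t" y "r *\<^sub>R x"] that r by (simp add: algebra_simps)
    also have "\<dots> = r * (p (x + t *\<^sub>R y) - t * p y)"
      using sublinear_scaleR[OF assms, of r "x + t *\<^sub>R y"] r by (simp add: algebra_simps)
    finally show ?thesis
      using r by (simp add: field_simps)
  qed
  from sublinear_shift_ge[OF this]
  show "sublinear_shift p y (r *\<^sub>R x) \<le> r * sublinear_shift p y x"
    using r by (simp add: field_simps)
qed

lemma sublinear_shift_le_self: "sublinear p \<Longrightarrow> sublinear_shift p y x \<le> p x"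
  using sublinear_shift_le[of p 0 y x] by simp

text \<open>A minimal sublinear functional agrees with all of its shifts, which forces it to be linear.\<close>

theorem hahn_banach_sublinear:
  fixes p :: "'v::real_vector \<Rightarrow> real"
  assumes p: "sublinear p"
  obtains f where "linear f" "\<And>z. f z \<le> p z" "f x = p x"
proof -
  \<comment> \<open>Staying below the shift rather than merely below \<open>p\<close> forces
    \<open>q (- x) \<le> - p x\<close>, which in the end gives equality at \<open>x\<close>. The
    order is reversed in \<open>P\<close> because Zorn's lemma yields maximal elements and a minimal
    one is wanted.\<close>
  define A where "A = {q. sublinear q \<and> q \<le> sublinear_shift p x}"
  define P where "P = (\<lambda>q r :: 'v \<Rightarrow> real. r \<le> q)"
  have px: "sublinear_shift p x \<in> A"
    using p by (simp add: A_def sublinear_sublinear_shift)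
  have "\<exists>m\<in>A. \<forall>q\<in>A. P m q \<longrightarrow> q = m"
  proof (rule predicate_Zorn)
    show "partial_order_on A (relation_of P A)"
      by (rule partial_order_on_relation_ofI) (auto simp: P_def)
  next
    fix C assume C: "C \<in> Chains (relation_of P A)"
    show "\<exists>u\<in>A. \<forall>q\<in>C. P q u"
    proof (cases "C = {}")
      case True
      then show ?thesis
        using px by auto
    next
      case False
      have CA: "sublinear q" "q z \<le> sublinear_shift p x z" if "q \<in> C" for q z
        using C that by (auto simp: Chains_def relation_of_def A_def le_fun_def)
      have chain: "q \<le> r \<or> r \<le> q" if "q \<in> C" "r \<in> C" for q r
        using C that by (auto simp: Chains_def relation_of_def P_def)
      define u where "u = (\<lambda>z. INF q\<in>C. q z)"
      \<comment> \<open>Sublinearity gives \<open>- q (- z) \<le> q z\<close>, and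
        \<open>q (- z)\<close> is bounded by the shift, so one lower bound serves the whole
        chain.\<close>
      have bdd: "bdd_below ((\<lambda>q. q z) ` C)" for z
      proof (rule bdd_belowI2)
        fix q assume "q \<in> C"
        then show "- sublinear_shift p x (- z) \<le> q z"
          using CA(2)[of q "- z"] sublinear_minus[OF CA(1), of q z] by linarith
      qed
      have u_le: "u z \<le> q z" if "q \<in> C" for q z
        unfolding u_def using bdd that by (intro cINF_lower)
      have u_ge: "c \<le> u z" if "\<And>q. q \<in> C \<Longrightarrow> c \<le> q z" for c z
        unfolding u_def using False that by (intro cINF_greatest)
      have "sublinear u"
      proof (rule sublinearI)
        fix y z
        \<comment> \<open>The two infima on the right run over the chain independently; for each
          pair, subadditivity of its smaller member bounds both terms at once.\<close>
        have *: "u (y + z) - r z \<le> q y" if "q \<in> C" "r \<in> C" for q r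
          using chain[OF that]
        proof
          assume "q \<le> r"
          then show ?thesis
            using u_le[OF that(1), of "y + z"] sublinear_add[OF CA(1)[OF that(1)], of y z]
            by (auto simp: le_fun_def dest!: spec[of _ z])
        next
          assume "r \<le> q"
          then show ?thesis
            using u_le[OF that(2), of "y + z"] sublinear_add[OF CA(1)[OF that(2)], of y z]
            by (auto simp: le_fun_def dest!: spec[of _ y])
        qed
        have "u (y + z) - u y \<le> r z" if "r \<in> C" for r
          using u_ge[OF *[OF _ that]] by (simp add: algebra_simps)
        from u_ge[OF this] show "u (y + z) \<le> u y + u z"
          by (simp add: algebra_simps)
      next
        fix r :: real and z assume r: "r > 0"
        have "u (r *\<^sub>R z) / r \<le> q z" if "q \<in> C" for q
          using u_le[OF that, of "r *\<^sub>R z"] sublinear_scaleR_le[OF CA(1)[OF that] r, of z] r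
          by (simp add: field_simps)
        from u_ge[OF this] show "u (r *\<^sub>R z) \<le> r * u z"
          using r by (simp add: field_simps)
      qed
      moreover have "u \<le> sublinear_shift p x"
      proof (rule le_funI)
        fix z
        obtain q where "q \<in> C"
          using False by blast
        then show "u z \<le> sublinear_shift p x z"
          using u_le[of q z] CA(2)[of q z] by linarith
      qed
      ultimately have "u \<in> A"
        by (simp add: A_def)
      then show ?thesis
        using u_le by (auto simp: P_def le_fun_def)
    qed
  qed
  then obtain m where m: "m \<in> A" and min: "\<And>q. q \<in> A \<Longrightarrow> q \<le> m \<Longrightarrow> q = m"
    by (auto simp: P_def)
  have sub: "sublinear m" and m_le: "\<And>z. m z \<le> sublinear_shift p x z"
    using m by (auto simp: A_def le_fun_def)
  have shift: "sublinear_shift m y = m" for y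
    by (rule min) (use m sublinear_shift_le_self[OF sub] in
      \<open>auto simp: A_def le_fun_def intro: sublinear_sublinear_shift order_trans\<close>)
  have neg: "m (- y) = - m y" for y
    using sublinear_shift_minus[OF sub, of y] sublinear_minus[OF sub, of y] by (simp add: shift)
  have add: "m (y + z) = m y + m z" for y z
    using sublinear_add[OF sub, of y z] sublinear_add[OF sub, of "y + z" "- z"] by (simp add: neg)
  have "m (r *\<^sub>R y) = r * m y" for r y
    using sublinear_scaleR[OF sub, of r y] sublinear_scaleR[OF sub, of "- r" y]
    by (cases "r \<ge> 0") (auto simp: neg)
  then have "linear m"
    using add by (auto intro: linearI)
  moreover have le: "m z \<le> p z" for z
    using m_le[of z] sublinear_shift_le_self[OF p, of x z] by linarith
  moreover have "m x = p x"
    using m_le[of "- x"] sublinear_shift_minus[OF p, of x] le[of x] by (simp add: neg)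
  ultimately show ?thesis
    using that by blast
qed

section \<open>Hahn--Banach consequences over the scalar field\<close>

lemma (in normed_space_over) continuous_functional_in_dual:
  assumes "\<And>x y. f (x + y) = f x + f y" "\<And>c x. f (sc c x) = c * f x" "\<And>x. norm (f x) \<le> K * norm x"
  shows "Blinfun f \<in> dual_space sc" "blinfun_apply (Blinfun f) = f"
proof -
  have "bounded_linear f"
    by (rule bounded_linear_intro[of _ K])
      (use assms in \<open>auto simp: sc_of_real[symmetric] scaleR_conv_of_real mult.commute\<close>)
  then show "blinfun_apply (Blinfun f) = f"
    by (rule bounded_linear_Blinfun_apply)
  then show "Blinfun f \<in> dual_space sc"
    using assms(2) by (simp add: dual_space_iff)
qed

text \<open>In the complex case the real functional \<open>f\<close> is completed to
  \<open>f z - j f (j z)\<close>. Its modulus is controlled by rotation: a suitable unimodular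
  multiple of \<open>z\<close> has a nonnegative real value, which is then a value of
  \<open>f\<close>, and \<open>p\<close> is invariant under the rotation.\<close>

lemma (in normed_space_over) hahn_banach_seminorm:
  fixes p :: "'v \<Rightarrow> real"
  assumes add: "\<And>x y. p (x + y) \<le> p x + p y" and homog: "\<And>c x. p (sc c x) = norm c * p x"
  obtains G :: "'v \<Rightarrow> 'k" where "\<And>x y. G (x + y) = G x + G y" "\<And>c x. G (sc c x) = c * G x"
    "\<And>z. norm (G z) \<le> p z" "norm (G x) = p x"
proof -
  have p_scaleR: "p (r *\<^sub>R z) = \<bar>r\<bar> * p z" for r z
    using homog[of "of_real r" z] by (simp add: sc_of_real)
  have p_ge: "p z \<ge> 0" for z
    using add[of z "- z"] p_scaleR[of "-1" z] p_scaleR[of 0 z] by simp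
  have "sublinear p"
    by (rule sublinearI) (simp_all add: add p_scaleR)
  then obtain f where f: "linear f" and f_le: "\<And>z. f z \<le> p z" and fx: "f x = p x"
    using hahn_banach_sublinear by blast
  have f_add: "f (y + z) = f y + f z" and f_scaleR: "f (r *\<^sub>R z) = r * f z"
    and f_minus: "f (- z) = - f z" for r y z
    using f by (simp_all add: linear_add linear_scale linear_neg)
  \<comment> \<open>A lower bound at \<open>x\<close> suffices in the last conjunct: as
    \<open>f x = p x\<close>, the upper bound by \<open>p\<close> turns it into an equality. In the
    complex case it says that the modulus dominates the real part.\<close>
  have "\<exists>G. (\<forall>x y. G (x + y) = G x + G y) \<and> (\<forall>c x. G (sc c x) = c * G x) \<and>
    (\<forall>z. norm (G z) \<le> p z) \<and> norm (G x) \<ge> f x"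
    using real_or_complex_cases[where 'a = 'k]
  proof (elim disjE exE conjE)
    assume real: "\<forall>z::'k. \<exists>r. z = r *\<^sub>R 1"
    have "of_real (f (sc c z)) = c * (of_real (f z) :: 'k)" for c :: 'k and z
    proof -
      obtain r where "c = of_real r"
        using real by (auto simp: of_real_def)
      then show ?thesis
        by (simp add: sc_of_real f_scaleR)
    qed
    moreover have "\<bar>f z\<bar> \<le> p z" for z
      using f_le[of z] f_le[of "- z"] p_scaleR[of "-1" z] by (simp add: f_minus)
    ultimately show ?thesis
      by (intro exI[of _ "\<lambda>z. of_real (f z)"]) (auto simp: f_add)
  next
    fix j :: 'k
    assume j: "j * j = - 1" and all: "\<forall>z. \<exists>r s. z = r *\<^sub>R 1 + s *\<^sub>R j"
      and norm: "\<forall>r s. norm (r *\<^sub>R 1 + s *\<^sub>R j) = sqrt (r\<^sup>2 + s\<^sup>2)"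
    define G :: "'v \<Rightarrow> 'k" where "G = (\<lambda>z. f z *\<^sub>R 1 + (- f (sc j z)) *\<^sub>R j)"
    have Gadd: "G (y + z) = G y + G z" for y z
      by (simp add: G_def scale_right_distrib f_add algebra_simps)
    have Gr: "G (r *\<^sub>R z) = r *\<^sub>R G z" for r z
    proof -
      have "sc j (r *\<^sub>R z) = r *\<^sub>R sc j z"
        by (simp add: sc_of_real[symmetric] mult.commute)
      then show ?thesis
        by (simp add: G_def f_scaleR algebra_simps)
    qed
    have "sc j (sc j z) = - z" for z
      by (simp add: j)
    then have Gj: "G (sc j z) = j * G z" for z
      by (simp add: G_def f_minus algebra_simps j)
    have Gsc: "G (sc c z) = c * G z" for c z
    proof -
      obtain r s where c: "c = r *\<^sub>R 1 + s *\<^sub>R j"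
        using all by blast
      have "sc c z = r *\<^sub>R z + s *\<^sub>R sc j z"
        by (simp add: c scaleR_conv_of_real scale_left_distrib sc_of_real flip: scale_scale)
      then show ?thesis
        by (simp add: Gadd Gr Gj c algebra_simps)
    qed
    have "norm (G z) \<le> p z" for z
    proof -
      obtain u where u: "norm u = 1" "u * G z = of_real (norm (G z))"
        by (rule real_or_complex_phase)
      \<comment> \<open>The norm formula makes \<open>1\<close> and \<open>j\<close> independent
        over the reals, so both coefficients vanish and the rotated value is purely real.\<close>
      have "(norm (G z) - f (sc u z)) *\<^sub>R 1 + f (sc j (sc u z)) *\<^sub>R j = 0"
        using u(2) Gsc[of u z] by (simp add: G_def algebra_simps of_real_def)
      then have "norm (G z) = f (sc u z)"
        using norm[rule_format, of "norm (G z) - f (sc u z)" "f (sc j (sc u z))"]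
        by (simp add: sum_power2_eq_zero_iff)
      then show ?thesis
        using f_le[of "sc u z"] homog[of u z] u(1) by simp
    qed
    moreover have "f x \<le> norm (G x)"
      using norm[rule_format, of "f x" "- f (sc j x)"] real_sqrt_sum_squares_ge1[of "f x" "f (sc j x)"]
      by (simp add: G_def)
    ultimately show ?thesis
      using Gadd Gsc by blast
  qed
  then show ?thesis
    using that fx by (metis order_antisym)
qed

text \<open>The distance to \<open>W\<close> is a seminorm that vanishes on \<open>W\<close> and is
  at least \<open>d\<close> at \<open>x\<close>. A functional dominated by it and attaining it at
  \<open>x\<close> only has to be divided by its value there, which costs the factor
  \<open>1 / d\<close>.\<close>

lemma (in normed_space_over) hahn_banach_separation:
  assumes W: "subspace W" and d: "d > 0" "\<And>w. w \<in> W \<Longrightarrow> d \<le> norm (x - w)"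
  obtains f where "f \<in> dual_space sc" "\<And>w. w \<in> W \<Longrightarrow> blinfun_apply f w = 0"
    "blinfun_apply f x = 1" "norm f \<le> 1 / d"
proof -
  define p where "p = (\<lambda>z. INF w\<in>W. norm (z - w))"
  have W0: "0 \<in> W"
    using W by (rule subspace_0)
  have p_le: "p z \<le> norm (z - w)" if "w \<in> W" for z w
    unfolding p_def using that by (intro cINF_lower bdd_belowI2[of _ 0]) auto
  have p_ge: "c \<le> p z" if "\<And>w. w \<in> W \<Longrightarrow> c \<le> norm (z - w)" for c z
    unfolding p_def using that W0 by (intro cINF_greatest) auto
  have add: "p (y + z) \<le> p y + p z" for y z
  proof -
    have *: "p (y + z) - norm (z - w') \<le> norm (y - w)" if "w \<in> W" "w' \<in> W" for w w'
      using p_le[OF subspace_add[OF W that], of "y + z"] norm_triangle_ineq[of "y - w" "z - w'"]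
      by (simp add: algebra_simps)
    have "p (y + z) - p y \<le> norm (z - w')" if "w' \<in> W" for w'
      using p_ge[OF *[OF _ that]] by (simp add: algebra_simps)
    from p_ge[OF this] show ?thesis
      by simp
  qed
  have homog_le: "p (sc c z) \<le> norm c * p z" if "c \<noteq> 0" for c z
  proof -
    have "p (sc c z) / norm c \<le> norm (z - w)" if "w \<in> W" for w
    proof -
      have "p (sc c z) \<le> norm (sc c z - sc c w)"
        by (rule p_le[OF subspace_scale[OF W that]])
      also have "\<dots> = norm c * norm (z - w)"
        by (metis norm_sc scale_right_diff_distrib)
      finally show ?thesis
        using \<open>c \<noteq> 0\<close> by (simp add: field_simps)
    qed
    from p_ge[OF this] show ?thesis
      using that by (simp add: field_simps)
  qed
  have homog: "p (sc c z) = norm c * p z" for c z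
  proof (cases "c = 0")
    case True
    then show ?thesis
      using p_le[OF W0, of 0] p_ge[of 0 0] by simp
  next
    case False
    then show ?thesis
      using homog_le[of c z] homog_le[of "inverse c" "sc c z"]
      by (simp add: field_simps norm_divide)
  qed
  obtain G :: "'v \<Rightarrow> 'k" where G: "\<And>x y. G (x + y) = G x + G y" "\<And>c x. G (sc c x) = c * G x"
    "\<And>z. norm (G z) \<le> p z" "norm (G x) = p x"
    using hahn_banach_seminorm[of p, OF add homog] by blast
  have px: "d \<le> p x"
    using d(2) by (rule p_ge)
  have Gx: "G x \<noteq> 0"
    using px d(1) G(4) by auto
  define g where "g = (\<lambda>z. G z / G x)"
  have bd: "norm (g z) \<le> (1 / d) * norm z" for z
  proof -
    have "norm (g z) \<le> p z / p x"
      using G(3)[of z] px d(1) by (simp add: g_def norm_divide G(4) divide_right_mono)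
    also have "\<dots> \<le> norm z / d"
      using p_le[OF W0, of z] px d(1) by (intro frac_le) auto
    finally show ?thesis
      by simp
  qed
  have g: "Blinfun g \<in> dual_space sc" "blinfun_apply (Blinfun g) = g"
    by (rule continuous_functional_in_dual[where K = "1 / d"];
        use bd in \<open>simp add: g_def G add_divide_distrib\<close>)+
  have "g w = 0" if "w \<in> W" for w
    using order_trans[OF G(3) p_le[OF that, of w]] by (simp add: g_def)
  moreover have "g x = 1"
    using Gx by (simp add: g_def)
  moreover have "norm (Blinfun g) \<le> 1 / d"
    by (rule norm_blinfun_bound) (use bd d(1) in \<open>auto simp: g(2)\<close>)
  ultimately show ?thesis
    using that[of "Blinfun g"] g by metis
qed

text \<open>Separation is applied to the kernel \<open>K\<close> of \<open>F\<close> and a vector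
  \<open>m0\<close> with \<open>F m0 = 1\<close>. Since \<open>M\<close> is the sum of
  \<open>K\<close> and the line through \<open>m0\<close>, the separating functional agrees with
  \<open>F\<close> on \<open>M\<close>, and its norm bound is exactly \<open>C\<close>.\<close>

lemma (in normed_space_over) hahn_banach_extension:
  assumes M: "subspace M" and C: "C \<ge> 0"
    and F: "\<And>x y. x \<in> M \<Longrightarrow> y \<in> M \<Longrightarrow> F (x + y) = F x + F y"
      "\<And>c x. x \<in> M \<Longrightarrow> F (sc c x) = c * F x"
      "\<And>x. x \<in> M \<Longrightarrow> norm (F x) \<le> C * norm x"
  obtains f where "f \<in> dual_space sc" "\<And>x. x \<in> M \<Longrightarrow> blinfun_apply f x = F x" "norm f \<le> C"
proof (cases "\<forall>x\<in>M. F x = 0")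
  case True
  show ?thesis
    by (rule that[of 0]) (use True C in \<open>auto simp: dual_space_iff\<close>)
next
  case False
  then obtain m where m: "m \<in> M" "F m \<noteq> 0"
    by blast
  define m0 where "m0 = sc (inverse (F m)) m"
  have m0: "m0 \<in> M" "F m0 = 1"
    using m M by (auto simp: m0_def subspace_scale F(2))
  have Fdiff: "F (x - y) = F x - F y" if "x \<in> M" "y \<in> M" for x y
    using F(1)[of "x - y" y] that M by (simp add: subspace_diff)
  have "F 0 = 0"
    using F(1)[of 0 0] M by (simp add: subspace_0)
  define K where "K = {x \<in> M. F x = 0}"
  have K: "subspace K"
    using M by (auto simp: K_def subspace_def F \<open>F 0 = 0\<close>)
  have C0: "C > 0"
    using F(3)[OF m0(1)] C by (cases "C = 0") (auto simp: m0(2))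
  \<comment> \<open>Subtracting a kernel element leaves the value 1 unchanged, so the bound on
    \<open>F\<close> reads \<open>1 \<le> C * norm (m0 - w)\<close>.\<close>
  have dist: "1 / C \<le> norm (m0 - w)" if "w \<in> K" for w
    using F(3)[of "m0 - w"] that m0 C0 M
    by (simp add: K_def Fdiff subspace_diff field_simps)
  from C0 have "1 / C > 0"
    by simp
  then obtain f where f: "f \<in> dual_space sc" "\<And>w. w \<in> K \<Longrightarrow> blinfun_apply f w = 0"
    "blinfun_apply f m0 = 1" "norm f \<le> 1 / (1 / C)"
    using hahn_banach_separation[OF K _ dist] by blast
  show ?thesis
  proof (rule that[OF f(1)])
    fix x assume x: "x \<in> M"
    have "x - sc (F x) m0 \<in> K"
      using x m0 M by (simp add: K_def subspace_diff subspace_scale Fdiff F(2))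
    from f(2)[OF this] show "blinfun_apply f x = F x"
      using f(1,3) by (simp add: blinfun.diff_right dual_space_iff)
  next
    show "norm f \<le> C"
      using f(4) by simp
  qed
qed

lemma (in normed_space_over) norming_functional:
  obtains f where "f \<in> dual_space sc" "norm f \<le> 1" "norm (blinfun_apply f x) = norm x"
proof -
  obtain G :: "'v \<Rightarrow> 'k" where G: "\<And>x y. G (x + y) = G x + G y" "\<And>c x. G (sc c x) = c * G x"
    "\<And>z. norm (G z) \<le> norm z" "norm (G x) = norm x"
    using hahn_banach_seminorm[of norm, OF norm_triangle_ineq norm_sc] by blast
  have g: "Blinfun G \<in> dual_space sc" "blinfun_apply (Blinfun G) = G"
    by (rule continuous_functional_in_dual[where K = 1]; use G in simp)+
  show ?thesis
    by (rule that[OF g(1)]) (auto intro!: norm_blinfun_bound simp: g(2) G)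
qed

text \<open>This makes the separation lemma available one level up, for subspaces of the space of
  functionals.\<close>

lemma normed_space_over_dual_scale:
  "normed_space_over
    (dual_scale :: 'k::real_or_complex \<Rightarrow> ('e::real_normed_vector \<Rightarrow>\<^sub>L 'k) \<Rightarrow> ('e \<Rightarrow>\<^sub>L 'k))"
proof unfold_locales
  have le: "norm (dual_scale c f) \<le> norm c * norm f" for c :: 'k and f :: "'e \<Rightarrow>\<^sub>L 'k"
    by (rule norm_blinfun_bound)
      (auto simp: norm_mult mult.assoc intro!: mult_left_mono norm_blinfun)
  show "norm (dual_scale c f) = norm c * norm f" for c :: 'k and f :: "'e \<Rightarrow>\<^sub>L 'k"
  proof (cases "c = 0")
    case True
    then show ?thesis
      using le[of c f] by simp
  next
    case False
    then have "dual_scale (inverse c) (dual_scale c f) = f"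
      by (intro blinfun_eqI) simp
    then show ?thesis
      using le[of c f] le[of "inverse c" "dual_scale c f"] False
      by (simp add: norm_divide divide_simps mult.commute)
  qed
qed (auto intro!: blinfun_eqI simp: blinfun.bilinear_simps algebra_simps scaleR_conv_of_real)

subsection \<open>Rosenthal's lemma\<close>

text \<open>If no part of a partition into infinitely many infinite sets works, picking a bad row from
  each part lowers the bound on the off-diagonal row sums by \<open>\<epsilon>\<close>.\<close>

lemma rosenthal_lemma_multiple:
  fixes m :: "nat \<Rightarrow> nat \<Rightarrow> real"
  assumes "\<epsilon> > 0" "\<And>k j. m k j \<ge> 0"
    and "\<And>k F. finite F \<Longrightarrow> k \<notin> F \<Longrightarrow> (\<Sum>j\<in>F. m k j) \<le> of_nat n * \<epsilon>"
  shows "\<exists>r::nat \<Rightarrow> nat. inj r \<and> (\<forall>k F. finite F \<longrightarrow> k \<notin> F \<longrightarrow> (\<Sum>j\<in>F. m (r k) (r j)) \<le> \<epsilon>)"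
  using assms(2,3)
proof (induction n arbitrary: m)
  case 0
  have "(\<Sum>j\<in>F. m k j) \<le> \<epsilon>" if "finite F" "k \<notin> F" for k F
    using 0(2)[OF that] assms(1) by simp
  then show ?case
    by (intro exI[of _ id]) simp
next
  case (Suc n)
  define part where "part = (\<lambda>p i::nat. prod_encode (p, i))"
  have part_eq: "part p i = part q j \<longleftrightarrow> p = q \<and> i = j" for p q i j
    by (simp add: part_def)
  show ?case
  proof (cases "\<exists>p. \<forall>k F. finite F \<longrightarrow> k \<notin> F \<longrightarrow> (\<Sum>j\<in>F. m (part p k) (part p j)) \<le> \<epsilon>")
    case True
    then obtain p where "\<forall>k F. finite F \<longrightarrow> k \<notin> F \<longrightarrow> (\<Sum>j\<in>F. m (part p k) (part p j)) \<le> \<epsilon>"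
      by blast
    then show ?thesis
      by (intro exI[of _ "part p"]) (auto simp: inj_on_def part_eq)
  next
    case False
    then have "\<forall>p. \<exists>k F. finite F \<and> k \<notin> F \<and> (\<Sum>j\<in>F. m (part p k) (part p j)) > \<epsilon>"
      by (meson not_le)
    then obtain K G where KG: "\<And>p. finite (G p)" "\<And>p. K p \<notin> G p"
      "\<And>p. (\<Sum>j\<in>G p. m (part p (K p)) (part p j)) > \<epsilon>"
      by metis
    define r where "r = (\<lambda>p. part p (K p))"
    have inj: "inj r"
      by (auto simp: inj_on_def r_def part_eq)
    have "(\<Sum>q\<in>F. m (r p) (r q)) \<le> of_nat n * \<epsilon>" if F: "finite F" "p \<notin> F" for p F
    proof -
      \<comment> \<open>The indices \<open>r q\<close> with \<open>q\<close> in \<open>F\<close> lie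
        in other parts, so the bad sum over \<open>G p\<close>, which exceeds
        \<open>\<epsilon>\<close>, comes on top of theirs in the same row and can be subtracted from
        the bound.\<close>
      have disj: "r ` F \<inter> part p ` G p = {}"
        using F(2) by (auto simp: r_def part_eq)
      have "(\<Sum>q\<in>F. m (r p) (r q)) + (\<Sum>j\<in>G p. m (r p) (part p j)) =
          (\<Sum>j\<in>r ` F. m (r p) j) + (\<Sum>j\<in>part p ` G p. m (r p) j)"
        using inj by (simp add: sum.reindex inj_on_def part_eq)
      also have "\<dots> = (\<Sum>j\<in>r ` F \<union> part p ` G p. m (r p) j)"
        using F(1) KG(1) disj by (simp add: sum.union_disjoint)
      also have "\<dots> \<le> of_nat (Suc n) * \<epsilon>"
        by (rule Suc.prems(2)) (use F KG(1,2) in \<open>auto simp: r_def part_eq\<close>)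
      finally show ?thesis
        using KG(3)[of p] by (simp add: r_def algebra_simps)
    qed
    then obtain s :: "nat \<Rightarrow> nat" where s: "inj s"
      "\<forall>k F. finite F \<longrightarrow> k \<notin> F \<longrightarrow> (\<Sum>j\<in>F. m (r (s k)) (r (s j))) \<le> \<epsilon>"
      using Suc.IH[of "\<lambda>p q. m (r p) (r q)"] Suc.prems(1) by blast
    then show ?thesis
      using inj_compose[OF inj s(1)] by (intro exI[of _ "r \<circ> s"]) (auto simp: o_def)
  qed
qed

theorem rosenthal_lemma:
  fixes m :: "nat \<Rightarrow> nat \<Rightarrow> real"
  assumes "\<epsilon> > 0" "\<And>k j. m k j \<ge> 0" "\<And>k F. finite F \<Longrightarrow> (\<Sum>j\<in>F. m k j) \<le> C"
  obtains r :: "nat \<Rightarrow> nat" where "inj r"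
    "\<And>k F. finite F \<Longrightarrow> k \<notin> F \<Longrightarrow> (\<Sum>j\<in>F. m (r k) (r j)) \<le> \<epsilon>"
proof -
  obtain n :: nat where n: "C / \<epsilon> \<le> of_nat n"
    using real_arch_simple by blast
  have "(\<Sum>j\<in>F. m k j) \<le> of_nat n * \<epsilon>" if "finite F" for k F
    using order_trans[OF assms(3)[OF that, of k], of "of_nat n * \<epsilon>"] n assms(1)
    by (simp add: field_simps)
  then show ?thesis
    using rosenthal_lemma_multiple[of \<epsilon> m n] assms(1,2) that by metis
qed

text \<open>A greedy choice: the state carries a number \<open>h\<close> above the current set and
  index, and the next set and index start at \<open>h\<close> or later. The index \<open>k\<close>
  allows the property of a block to depend on a member of a sequence, as is required for weakly
  Cauchy sequences.\<close>

lemma disjoint_blocks: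
  fixes P :: "nat set \<Rightarrow> nat \<Rightarrow> bool"
  assumes "\<And>N. \<exists>F k. finite F \<and> F \<subseteq> {N..} \<and> k \<ge> N \<and> P F k"
  shows "\<exists>F k. (\<forall>i::nat. finite (F i) \<and> P (F i) (k i)) \<and> disjoint_family F \<and> strict_mono k"
proof -
  let ?Q = "\<lambda>(F, k, h). finite F \<and> P F k \<and> F \<subseteq> {..<h} \<and> k < h"
  let ?R = "\<lambda>(F, k, h) (F', k', h'). F' \<subseteq> {h..} \<and> h \<le> k' \<and> h \<le> (h' :: nat)"
  have step: "\<exists>F k h'. ?Q (F, k, h') \<and> F \<subseteq> {h..} \<and> h \<le> k \<and> h \<le> h'" for h
  proof -
    obtain F k where F: "finite F" "F \<subseteq> {h..}" "k \<ge> h" "P F k"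
      using assms[of h] by blast
    then have "F \<subseteq> {..<Suc (Max (insert k F))}" "k < Suc (Max (insert k F))"
      by (auto simp: less_Suc_eq_le)
    with F show ?thesis
      by (intro exI[of _ F] exI[of _ k] exI[of _ "Suc (Max (insert k F))"]) auto
  qed
  have "\<exists>f. \<forall>i. ?Q (f i) \<and> ?R (f i) (f (Suc i))"
  proof (rule dependent_nat_choice)
    obtain F k h' where "?Q (F, k, h')"
      using step[of 0] by blast
    then show "\<exists>x. ?Q x" ..
  next
    fix x :: "nat set \<times> nat \<times> nat" and n :: nat
    obtain F k h' where "?Q (F, k, h')" "F \<subseteq> {snd (snd x)..}" "snd (snd x) \<le> k" "snd (snd x) \<le> h'"
      using step[of "snd (snd x)"] by blast
    then show "\<exists>y. ?Q y \<and> ?R x y"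
      by (intro exI[of _ "(F, k, h')"]) (simp add: case_prod_beta)
  qed
  then obtain f where f: "\<forall>i. ?Q (f i) \<and> ?R (f i) (f (Suc i))" ..
  define F k h where "F = (\<lambda>i. fst (f i))" and "k = (\<lambda>i. fst (snd (f i)))" and "h = (\<lambda>i. snd (snd (f i)))"
  have Q: "finite (F i)" "P (F i) (k i)" "F i \<subseteq> {..<h i}" "k i < h i" for i
    using f[rule_format, of i] by (auto simp: F_def k_def h_def case_prod_beta)
  have R: "F (Suc i) \<subseteq> {h i..}" "h i \<le> k (Suc i)" "h i \<le> h (Suc i)" for i
    using f[rule_format, of i] by (auto simp: F_def k_def h_def case_prod_beta)
  have "strict_mono k"
    by (rule strict_monoI_Suc) (meson Q(4) R(2) order_less_le_trans)
  moreover have disj: "F i \<inter> F j = {}" if "i < j" for i j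
  proof -
    obtain j' where j': "j = Suc j'" "i \<le> j'"
      using \<open>i < j\<close> by (cases j) auto
    have "h i \<le> h j'"
      using R(3) j'(2) by (rule lift_Suc_mono_le)
    then show ?thesis
      using Q(3)[of i] R(1)[of j'] by (fastforce simp: j'(1))
  qed
  then have "disjoint_family F"
    by (auto simp: disjoint_family_on_def) (metis disjoint_iff linorder_neqE_nat)
  ultimately show ?thesis
    using Q by blast
qed

subsection \<open>Copies of sequence spaces\<close>

text \<open>Injectivity follows from the lower estimate applied to the difference of two sequences
  with the same image, and linearity makes the image a subspace.\<close>

lemma (in normed_space_over) has_subspace_isomorphic_toI:
  fixes X :: "(nat \<Rightarrow> 'k) set" and T :: "(nat \<Rightarrow> 'k) \<Rightarrow> 'v"
  assumes X: "(\<lambda>_. 0) \<in> X" "\<And>s t. s \<in> X \<Longrightarrow> t \<in> X \<Longrightarrow> (\<lambda>n. s n + t n) \<in> X"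
      "\<And>c s. s \<in> X \<Longrightarrow> (\<lambda>n. c * s n) \<in> X"
    and N: "\<And>s. s \<in> X \<Longrightarrow> N s \<le> 0 \<Longrightarrow> s = (\<lambda>_. 0)"
    and T: "\<And>s t. s \<in> X \<Longrightarrow> t \<in> X \<Longrightarrow> T (\<lambda>n. s n + t n) = T s + T t"
      "\<And>c s. s \<in> X \<Longrightarrow> T (\<lambda>n. c * s n) = sc c (T s)"
    and bounds: "\<And>s. s \<in> X \<Longrightarrow> norm (T s) \<le> C * N s" "\<And>s. s \<in> X \<Longrightarrow> N s \<le> D * norm (T s)"
  shows "has_subspace_isomorphic_to sc X N"
proof -
  have "inj_on T X"
  proof (rule inj_onI)
    fix s t assume st: "s \<in> X" "t \<in> X" "T s = T t"
    have mt: "(\<lambda>n. - 1 * t n) \<in> X"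
      using X(3)[OF st(2), of "- 1"] .
    have "T (\<lambda>n. s n + - 1 * t n) = 0"
      using T(1)[OF st(1) mt] T(2)[OF st(2), of "- 1"] st(3) by simp
    with bounds(2)[OF X(2)[OF st(1) mt]] have "N (\<lambda>n. s n + - 1 * t n) \<le> 0"
      by simp
    from N[OF X(2)[OF st(1) mt] this] show "s = t"
      by (auto simp: fun_eq_iff)
  qed
  moreover have "subspace (T ` X)"
  proof (rule subspaceI)
    have "T (\<lambda>_. 0) = 0"
      using T(2)[OF X(1), of 0] by simp
    then show "0 \<in> T ` X"
      using X(1) by (metis imageI)
  next
    show "x + y \<in> T ` X" if "x \<in> T ` X" "y \<in> T ` X" for x y
      using that by (auto simp: T(1)[symmetric] X(2))
    show "sc c x \<in> T ` X" if "x \<in> T ` X" for c x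
      using that by (auto simp: T(2)[symmetric] X(3))
  qed
  ultimately show ?thesis
    unfolding has_subspace_isomorphic_to_def using T bounds
    by (intro exI[of _ "T ` X"] exI[of _ T] conjI exI[of _ C] exI[of _ D])
      (auto intro: inj_on_imp_bij_betw)
qed

lemma l1_space_add:
  fixes s t :: "nat \<Rightarrow> 'k::real_or_complex"
  assumes "s \<in> l1_space" "t \<in> l1_space"
  shows "(\<lambda>n. s n + t n) \<in> l1_space"
  unfolding l1_space_def mem_Collect_eq
proof (rule summable_comparison_test')
  show "summable (\<lambda>n. norm (s n) + norm (t n))"
    using assms by (simp add: l1_space_def summable_add)
qed (simp add: norm_triangle_ineq)

lemma l1_space_mult: "s \<in> l1_space \<Longrightarrow> (\<lambda>n. c * s n) \<in> l1_space"
  by (auto simp: l1_space_def norm_mult intro: summable_mult)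

lemma c0_space_add: "s \<in> c0_space \<Longrightarrow> t \<in> c0_space \<Longrightarrow> (\<lambda>n. s n + t n) \<in> c0_space"
  using tendsto_add[of s 0 sequentially t 0] by (simp add: c0_space_def)

lemma c0_space_mult: "s \<in> c0_space \<Longrightarrow> (\<lambda>n. c * s n) \<in> c0_space"
  by (simp add: c0_space_def tendsto_mult_right_zero)

lemma norm_le_sup_norm:
  assumes "s \<in> c0_space"
  shows "norm (s n) \<le> sup_norm s"
proof -
  have "Bseq s"
    using assms by (auto simp: c0_space_def intro: convergent_imp_Bseq convergentI)
  then have "bdd_above (range (\<lambda>n. norm (s n)))"
    by (auto simp: Bseq_def bdd_above_def)
  then show ?thesis
    unfolding sup_norm_def by (rule cSUP_upper2) auto
qed

lemma sup_norm_le: "(\<And>n. norm (s n) \<le> K) \<Longrightarrow> sup_norm s \<le> K"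
  unfolding sup_norm_def by (rule cSUP_least) auto

lemma norm_le_l1_norm:
  assumes "s \<in> l1_space"
  shows "(\<Sum>n\<in>F. norm (s n)) \<le> l1_norm s"
proof (cases "finite F")
  case True
  then show ?thesis
    using assms by (auto simp: l1_norm_def l1_space_def intro: sum_le_suminf)
next
  case False
  then show ?thesis
    using assms by (auto simp: l1_norm_def l1_space_def intro: suminf_nonneg)
qed

lemma l1_norm_le: "s \<in> l1_space \<Longrightarrow> (\<And>n. (\<Sum>i<n. norm (s i)) \<le> K) \<Longrightarrow> l1_norm s \<le> K"
  unfolding l1_norm_def l1_space_def by (auto intro: suminf_le_const)

lemma (in normed_space_over) sc_bounded_linear: "bounded_linear (sc c)"
proof (rule bounded_linear_intro[where K = "norm c"])
  show "sc c (r *\<^sub>R x) = r *\<^sub>R sc c x" for r x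
    by (simp add: sc_of_real[symmetric] mult.commute)
qed (simp_all add: scale_right_distrib norm_sc mult.commute)

lemma (in normed_space_over) dual_sc: "f \<in> dual_space sc \<Longrightarrow> blinfun_apply f (sc c x) = c * blinfun_apply f x"
  by (simp add: dual_space_iff)

lemma (in normed_space_over) dual_sum_sc:
  "f \<in> dual_space sc \<Longrightarrow> blinfun_apply f (\<Sum>n\<in>F. sc (c n) (x n)) = (\<Sum>n\<in>F. c n * blinfun_apply f (x n))"
  by (simp add: blinfun.sum_right dual_sc)

lemma (in normed_space_over) norm_le_of_dual:
  assumes "\<And>f. f \<in> dual_space sc \<Longrightarrow> norm f \<le> 1 \<Longrightarrow> norm (blinfun_apply f x) \<le> K"
  shows "norm x \<le> K"
  by (rule norming_functional[of x]) (use assms in metis)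

lemma norm_blinfun_apply_le_1: "norm f \<le> 1 \<Longrightarrow> norm (blinfun_apply f x) \<le> norm x"
  using norm_blinfun[of f x] mult_right_mono[of "norm f" 1 "norm x"] by simp

text \<open>The upper estimate is the triangle inequality. For the lower one, \<open>T s\<close> is
  tested against a finite combination \<open>W\<close> of the \<open>w j\<close> whose phases make
  the diagonal terms nonnegative. By \<open>total\<close> the value is at most
  \<open>C * norm (T s)\<close>; by \<open>diag\<close> and \<open>off\<close> it is at least
  \<open>\<delta>\<close> times a partial sum of the norm of \<open>s\<close>, minus
  \<open>\<delta> / 2\<close> times the full norm.\<close>

lemma l1_subspaceI:
  fixes sc :: "'k::real_or_complex \<Rightarrow> 'e::banach \<Rightarrow> 'e"
    and x :: "nat \<Rightarrow> 'e" and w :: "nat \<Rightarrow> 'e \<Rightarrow>\<^sub>L 'k"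
  assumes "normed_space_over sc"
    and x: "\<And>k. norm (x k) \<le> 1"
    and w: "\<And>j. w j \<in> dual_space sc"
    and diag: "\<And>k. norm (blinfun_apply (w k) (x k)) \<ge> \<delta>"
    and off: "\<And>k F. finite F \<Longrightarrow> k \<notin> F \<Longrightarrow> (\<Sum>j\<in>F. norm (blinfun_apply (w j) (x k))) \<le> \<delta> / 2"
    and total: "\<And>z F. finite F \<Longrightarrow> (\<Sum>j\<in>F. norm (blinfun_apply (w j) z)) \<le> C * norm z"
    and \<delta>: "\<delta> > 0"
  shows "has_subspace_isomorphic_to sc l1_space l1_norm"
proof -
  interpret normed_space_over sc by fact
  define T where "T = (\<lambda>s. \<Sum>k. sc (s k) (x k))"
  have le: "norm (sc (s k) (x k)) \<le> norm (s k)" for s k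
    using mult_left_mono[OF x[of k], of "norm (s k)"] by (simp add: norm_sc)
  have summ: "summable (\<lambda>k. norm (sc (s k) (x k)))" if "s \<in> l1_space" for s
    by (rule summable_comparison_test[of _ "\<lambda>k. norm (s k)"])
      (use le that in \<open>auto simp: l1_space_def\<close>)
  note summ' = summable_norm_cancel[OF summ]
  show ?thesis
  proof (rule has_subspace_isomorphic_toI[where T = T])
    show "(\<lambda>_. 0) \<in> (l1_space :: (nat \<Rightarrow> 'k) set)"
      by (simp add: l1_space_def)
    show "s = (\<lambda>_. 0)" if "s \<in> l1_space" "l1_norm s \<le> 0" for s :: "nat \<Rightarrow> 'k"
    proof
      fix n
      have "norm (s n) \<le> l1_norm s"
        using norm_le_l1_norm[OF that(1), of "{n}"] by simp
      then have "norm (s n) \<le> 0"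
        using that(2) by (rule order_trans)
      then show "s n = 0"
        by simp
    qed
    show "T (\<lambda>n. s n + t n) = T s + T t" if "s \<in> l1_space" "t \<in> l1_space" for s t
      using that by (simp add: T_def scale_left_distrib suminf_add summ')
    show "T (\<lambda>n. c * s n) = sc c (T s)" if "s \<in> l1_space" for c s
      using bounded_linear.suminf[OF sc_bounded_linear[of c] summ'[OF that]] by (simp add: T_def)
    show "norm (T s) \<le> 1 * l1_norm s" if "s \<in> l1_space" for s
    proof -
      have "norm (T s) \<le> (\<Sum>k. norm (sc (s k) (x k)))"
        unfolding T_def by (rule summable_norm[OF summ[OF that]])
      also have "\<dots> \<le> l1_norm s"
        unfolding l1_norm_def by (rule suminf_le[OF _ summ[OF that]]) (use le that in \<open>auto simp: l1_space_def\<close>)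
      finally show ?thesis
        by simp
    qed
  next
    fix s :: "nat \<Rightarrow> 'k" assume s: "s \<in> l1_space"
    \<comment> \<open>The norm of \<open>s\<close> appears on the right as well. It is finite and
      has the factor 1/2 there, so after \<open>n\<close> tends to infinity it is absorbed, which
      gives the constant \<open>2 * C / \<delta>\<close>.\<close>
    have "(\<Sum>i<n. norm (s i)) \<le> (C * norm (T s) + \<delta> / 2 * l1_norm s) / \<delta>" for n
    proof -
      obtain \<theta> where \<theta>: "\<And>j. norm (\<theta> j) = 1"
        "\<And>j. \<theta> j * (s j * blinfun_apply (w j) (x j)) = of_real (norm (s j * blinfun_apply (w j) (x j)))"
        using real_or_complex_phases[of "\<lambda>j. s j * blinfun_apply (w j) (x j)"] by blast
      define W where "W = (\<lambda>z. \<Sum>j<n. \<theta> j * blinfun_apply (w j) z)"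
      have W_bl: "bounded_linear W"
        unfolding W_def
        by (intro bounded_linear_sum bounded_linear_const_mult blinfun.bounded_linear_right)
      have W_le: "norm (W z) \<le> (\<Sum>j<n. norm (blinfun_apply (w j) z))" for z
        unfolding W_def by (rule sum_norm_le) (simp add: norm_mult \<theta>)
      \<comment> \<open>\<open>E k\<close> is the off-diagonal part of the \<open>k\<close>-th term.
        For \<open>k \<ge> n\<close> the functional \<open>W\<close> contains no diagonal summand,
        so nothing is removed.\<close>
      define E where "E = (\<lambda>k. s k * W (x k) - (if k < n then of_real (norm (s k * blinfun_apply (w k) (x k))) else 0))"
      have E_le: "norm (E k) \<le> \<delta> / 2 * norm (s k)" for k
      proof -
        have "W (x k) - (if k < n then \<theta> k * blinfun_apply (w k) (x k) else 0) =
            (\<Sum>j\<in>{..<n} - {k}. \<theta> j * blinfun_apply (w j) (x k))"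
          unfolding W_def by (simp add: sum_diff1)
        also have "norm \<dots> \<le> (\<Sum>j\<in>{..<n} - {k}. norm (blinfun_apply (w j) (x k)))"
          by (rule sum_norm_le) (simp add: norm_mult \<theta>)
        also have "\<dots> \<le> \<delta> / 2"
          by (rule off) auto
        finally have "norm (s k) * norm (W (x k) - (if k < n then \<theta> k * blinfun_apply (w k) (x k) else 0)) \<le> norm (s k) * (\<delta> / 2)"
          by (rule mult_left_mono) simp
        moreover have "E k = s k * (W (x k) - (if k < n then \<theta> k * blinfun_apply (w k) (x k) else 0))"
          unfolding E_def using \<theta>(2)[of k] by (auto simp: algebra_simps)
        ultimately show ?thesis
          by (simp add: norm_mult mult.commute)
      qed
      have W_sc: "W (sc c z) = c * W z" for c z
        by (simp add: W_def dual_sc[OF w] sum_distrib_left mult.left_commute)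
      have WT: "(\<lambda>k. s k * W (x k)) sums W (T s)"
        using bounded_linear.sums[OF W_bl summable_sums[OF summ'[OF s]]] by (simp add: T_def W_sc)
      have fin: "(\<lambda>k. if k < n then of_real (norm (s k * blinfun_apply (w k) (x k))) else 0) sums
          (\<Sum>k<n. of_real (norm (s k * blinfun_apply (w k) (x k))) :: 'k)"
        using sums_If_finite_set[of "{..<n}"] by simp
      have E_sums: "E sums (W (T s) - (\<Sum>k<n. of_real (norm (s k * blinfun_apply (w k) (x k)))))"
        unfolding E_def by (rule sums_diff[OF WT fin])
      have sE: "summable (\<lambda>k. \<delta> / 2 * norm (s k))"
        using s by (auto simp: l1_space_def intro: summable_mult)
      have nE: "summable (\<lambda>k. norm (E k))"
        by (rule summable_comparison_test[OF _ sE]) (use E_le in auto)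
      have "norm (W (T s) - (\<Sum>k<n. of_real (norm (s k * blinfun_apply (w k) (x k))))) \<le> (\<Sum>k. norm (E k))"
        using summable_norm[OF nE] E_sums by (simp add: sums_iff)
      also have "\<dots> \<le> (\<Sum>k. \<delta> / 2 * norm (s k))"
        by (rule suminf_le[OF E_le nE sE])
      also have "\<dots> = \<delta> / 2 * l1_norm s"
        using s suminf_mult[of "\<lambda>k. norm (s k)" "\<delta> / 2"] by (simp only: l1_norm_def l1_space_def mem_Collect_eq)
      finally have 1: "norm (W (T s) - of_real (\<Sum>k<n. norm (s k * blinfun_apply (w k) (x k)))) \<le> \<delta> / 2 * l1_norm s"
        by simp
      have 2: "norm (W (T s)) \<le> C * norm (T s)"
        using W_le[of "T s"] total[of "{..<n}" "T s"] by simp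
      have 3: "\<delta> * (\<Sum>k<n. norm (s k)) \<le> (\<Sum>k<n. norm (s k * blinfun_apply (w k) (x k)))"
        unfolding sum_distrib_left
        by (rule sum_mono) (simp add: norm_mult mult.commute[of \<delta>] mult_left_mono diag)
      have 4: "norm (of_real (\<Sum>k<n. norm (s k * blinfun_apply (w k) (x k))) :: 'k) = (\<Sum>k<n. norm (s k * blinfun_apply (w k) (x k)))"
        by (simp only: norm_of_real abs_of_nonneg sum_nonneg norm_ge_zero)
      have "\<delta> * (\<Sum>k<n. norm (s k)) \<le> C * norm (T s) + \<delta> / 2 * l1_norm s"
        using 1 2 3 4 norm_triangle_ineq3[of "of_real (\<Sum>k<n. norm (s k * blinfun_apply (w k) (x k)))" "W (T s)"]
          norm_minus_commute[of "W (T s)" "of_real (\<Sum>k<n. norm (s k * blinfun_apply (w k) (x k)))"]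
        by linarith
      then show ?thesis
        using \<delta> by (simp add: field_simps)
    qed
    then have "l1_norm s \<le> (C * norm (T s) + \<delta> / 2 * l1_norm s) / \<delta>"
      by (rule l1_norm_le[OF s])
    then show "l1_norm s \<le> (2 * C / \<delta>) * norm (T s)"
      using \<delta> by (simp add: field_simps)
  qed (fact l1_space_add l1_space_mult c0_space_add c0_space_mult)+
qed

text \<open>By duality \<open>total\<close> bounds every finite combination of the
  \<open>v j\<close> by \<open>C\<close> times its largest coefficient; this gives both the
  convergence of the series for null sequences and the upper estimate. For the lower one,
  \<open>f k\<close> reads off the \<open>k\<close>-th coefficient with weight at least
  \<open>\<delta>\<close> and error at most half of \<open>\<delta>\<close> times the sup
  norm.\<close>

lemma c0_subspaceI:
  fixes sc :: "'k::real_or_complex \<Rightarrow> 'e::banach \<Rightarrow> 'e"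
    and v :: "nat \<Rightarrow> 'e" and f :: "nat \<Rightarrow> 'e \<Rightarrow>\<^sub>L 'k"
  assumes "normed_space_over sc"
    and f: "\<And>k. f k \<in> dual_space sc" "\<And>k. norm (f k) \<le> 1"
    and diag: "\<And>k. norm (blinfun_apply (f k) (v k)) \<ge> \<delta>"
    and off: "\<And>k F. finite F \<Longrightarrow> k \<notin> F \<Longrightarrow> (\<Sum>j\<in>F. norm (blinfun_apply (f k) (v j))) \<le> \<delta> / 2"
    and total: "\<And>y F. y \<in> dual_space sc \<Longrightarrow> finite F \<Longrightarrow>
      (\<Sum>j\<in>F. norm (blinfun_apply y (v j))) \<le> C * norm y"
    and C: "C \<ge> 0" and \<delta>: "\<delta> > 0"
  shows "has_subspace_isomorphic_to sc c0_space sup_norm"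
proof -
  interpret normed_space_over sc by fact
  define T where "T = (\<lambda>s. \<Sum>k. sc (s k) (v k))"
  have bound: "norm (\<Sum>j\<in>F. sc (s j) (v j)) \<le> C * K"
    if "finite F" "K \<ge> 0" "\<And>j. j \<in> F \<Longrightarrow> norm (s j) \<le> K" for F K s
  proof (rule norm_le_of_dual)
    fix y :: "'e \<Rightarrow>\<^sub>L 'k" assume y: "y \<in> dual_space sc" "norm y \<le> 1"
    have "norm (blinfun_apply y (\<Sum>j\<in>F. sc (s j) (v j))) \<le> (\<Sum>j\<in>F. norm (s j) * norm (blinfun_apply y (v j)))"
      unfolding dual_sum_sc[OF y(1)] by (rule sum_norm_le) (simp add: norm_mult)
    also have "\<dots> \<le> (\<Sum>j\<in>F. K * norm (blinfun_apply y (v j)))"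
      by (intro sum_mono mult_right_mono that) auto
    also have "\<dots> \<le> K * (C * norm y)"
      unfolding sum_distrib_left[symmetric] by (intro mult_left_mono total y that)
    also have "\<dots> \<le> K * (C * 1)"
      by (intro mult_left_mono y that C)
    finally show "norm (blinfun_apply y (\<Sum>j\<in>F. sc (s j) (v j))) \<le> C * K"
      by (simp add: mult.commute)
  qed
  have summ: "summable (\<lambda>k. sc (s k) (v k))" if s: "s \<in> c0_space" for s
    unfolding summable_Cauchy
  proof (intro allI impI)
    fix e :: real assume e: "e > 0"
    \<comment> \<open>The added 1 covers \<open>C = 0\<close> and makes the final inequality
      strict.\<close>
    then have "e / (C + 1) > 0"
      using C by simp
    moreover have "s \<longlonglongrightarrow> 0"
      using s by (simp add: c0_space_def)
    ultimately obtain N where N: "\<And>n. n \<ge> N \<Longrightarrow> norm (s n) < e / (C + 1)"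
      by (metis LIMSEQ_iff diff_zero)
    have "norm (\<Sum>k = m..<n. sc (s k) (v k)) < e" if "m \<ge> N" for m n
    proof -
      have "norm (\<Sum>k = m..<n. sc (s k) (v k)) \<le> C * (e / (C + 1))"
      proof (rule bound)
        show "norm (s j) \<le> e / (C + 1)" if "j \<in> {m..<n}" for j
          using N[of j] that \<open>m \<ge> N\<close> by simp
      qed (use e C in auto)
      also have "\<dots> < e"
        using e C by (simp add: field_simps)
      finally show ?thesis .
    qed
    then show "\<exists>N. \<forall>m\<ge>N. \<forall>n. norm (\<Sum>k = m..<n. sc (s k) (v k)) < e"
      by blast
  qed
  have lim: "(\<lambda>n. \<Sum>k<n. sc (s k) (v k)) \<longlonglongrightarrow> T s" if "s \<in> c0_space" for s
    using summable_LIMSEQ[OF summ[OF that]] by (simp add: T_def)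
  show ?thesis
  proof (rule has_subspace_isomorphic_toI[where T = T])
    show "(\<lambda>_. 0) \<in> (c0_space :: (nat \<Rightarrow> 'k) set)"
      by (simp add: c0_space_def)
    show "s = (\<lambda>_. 0)" if "s \<in> c0_space" "sup_norm s \<le> 0" for s :: "nat \<Rightarrow> 'k"
    proof
      fix n
      have "norm (s n) \<le> 0"
        using norm_le_sup_norm[OF that(1), of n] that(2) by linarith
      then show "s n = 0"
        by simp
    qed
    show "T (\<lambda>n. s n + t n) = T s + T t" if "s \<in> c0_space" "t \<in> c0_space" for s t
      using that by (simp add: T_def scale_left_distrib suminf_add summ)
    show "T (\<lambda>n. c * s n) = sc c (T s)" if "s \<in> c0_space" for c s
      using bounded_linear.suminf[OF sc_bounded_linear[of c] summ[OF that]] by (simp add: T_def)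
  next
    fix s :: "nat \<Rightarrow> 'k" assume s: "s \<in> c0_space"
    have S: "norm (s n) \<le> sup_norm s" for n
      using s by (rule norm_le_sup_norm)
    have S0: "0 \<le> sup_norm s"
      using S[of 0] norm_ge_zero order_trans by blast
    show "norm (T s) \<le> C * sup_norm s"
      by (rule LIMSEQ_le_const2[OF tendsto_norm[OF lim[OF s]]]) (use bound S S0 in auto)
    have "norm (s k) \<le> (norm (T s) + \<delta> / 2 * sup_norm s) / \<delta>" for k
    proof -
      have "norm (s k) * \<delta> - \<delta> / 2 * sup_norm s \<le> norm (\<Sum>j<n. sc (s j) (v j))" if "n > k" for n
      proof -
        have eq: "(\<Sum>j<n. s j * blinfun_apply (f k) (v j)) =
            s k * blinfun_apply (f k) (v k) + (\<Sum>j\<in>{..<n} - {k}. s j * blinfun_apply (f k) (v j))"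
          using that by (simp add: sum.remove)
        have "norm (\<Sum>j\<in>{..<n} - {k}. s j * blinfun_apply (f k) (v j)) \<le>
            (\<Sum>j\<in>{..<n} - {k}. sup_norm s * norm (blinfun_apply (f k) (v j)))"
          by (rule sum_norm_le) (auto simp: norm_mult intro: mult_right_mono S)
        also have "\<dots> \<le> sup_norm s * (\<delta> / 2)"
          unfolding sum_distrib_left[symmetric] by (intro mult_left_mono off S0) auto
        finally have "norm (s k) * norm (blinfun_apply (f k) (v k)) - \<delta> / 2 * sup_norm s \<le>
            norm (\<Sum>j<n. s j * blinfun_apply (f k) (v j))"
          using norm_diff_ineq[of "s k * blinfun_apply (f k) (v k)"
              "\<Sum>j\<in>{..<n} - {k}. s j * blinfun_apply (f k) (v j)"]
          unfolding eq by (simp add: norm_mult mult.commute)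
        moreover have "norm (s k) * \<delta> \<le> norm (s k) * norm (blinfun_apply (f k) (v k))"
          by (intro mult_left_mono diag) auto
        moreover have "norm (\<Sum>j<n. s j * blinfun_apply (f k) (v j)) \<le> norm (\<Sum>j<n. sc (s j) (v j))"
          using norm_blinfun_apply_le_1[OF f(2), of k "\<Sum>j<n. sc (s j) (v j)"]
          by (simp add: dual_sum_sc[OF f(1)])
        ultimately show ?thesis
          by linarith
      qed
      then have "norm (s k) * \<delta> - \<delta> / 2 * sup_norm s \<le> norm (T s)"
        by (intro LIMSEQ_le_const[OF tendsto_norm[OF lim[OF s]]] exI[of _ "Suc k"]) auto
      then show ?thesis
        using \<delta> by (simp add: field_simps)
    qed
    then have "sup_norm s \<le> (norm (T s) + \<delta> / 2 * sup_norm s) / \<delta>"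
      by (rule sup_norm_le)
    then show "sup_norm s \<le> (2 / \<delta>) * norm (T s)"
      using \<delta> by (simp add: field_simps)
  qed (fact l1_space_add l1_space_mult c0_space_add c0_space_mult)+
qed

text \<open>Used to evaluate a copy of \<open>c_0\<close> on finite sequences of unimodular
  coefficients, whose sup norm is at most 1 however long they are.\<close>

lemma c0_finite_support:
  fixes T :: "(nat \<Rightarrow> 'k::real_or_complex) \<Rightarrow> 'v::real_normed_vector"
  assumes "normed_space_over sc"
    and T: "\<And>s t. s \<in> c0_space \<Longrightarrow> t \<in> c0_space \<Longrightarrow> T (\<lambda>n. s n + t n) = T s + T t"
      "\<And>c s. s \<in> c0_space \<Longrightarrow> T (\<lambda>n. c * s n) = sc c (T s)"
    and F: "finite F"
  shows "(\<lambda>n. if n \<in> F then \<theta> n else 0) \<in> c0_space \<and>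
    T (\<lambda>n. if n \<in> F then \<theta> n else 0) = (\<Sum>k\<in>F. sc (\<theta> k) (T (\<lambda>n. if n = k then 1 else 0)))"
  using F
proof induction
  case empty
  interpret normed_space_over sc by fact
  have 0: "(\<lambda>_. 0) \<in> (c0_space :: (nat \<Rightarrow> 'k) set)"
    by (simp add: c0_space_def)
  then show ?case
    using T(2)[OF 0, of 0] by simp
next
  case (insert k F)
  have c0: "(\<lambda>n. if n \<in> G then \<theta> n else 0) \<in> c0_space" if "finite G" for G and \<theta> :: "nat \<Rightarrow> 'k"
  proof -
    have "\<forall>\<^sub>F n in sequentially. n \<notin> G"
      using that unfolding cofinite_eq_sequentially[symmetric] eventually_cofinite by simp
    then have "(\<lambda>n. if n \<in> G then \<theta> n else 0) \<longlonglongrightarrow> 0"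
      by (intro tendsto_eventually) (auto elim: eventually_mono)
    then show ?thesis
      by (simp add: c0_space_def)
  qed
  have e: "(\<lambda>n. if n = k then 1 else 0) \<in> (c0_space :: (nat \<Rightarrow> 'k) set)"
    using c0[of "{k}" "\<lambda>_. 1"] by simp
  have ke: "(\<lambda>n. \<theta> k * (if n = k then 1 else 0)) \<in> c0_space"
    using c0[of "{k}" \<theta>] by (simp add: if_distrib[of "(*) _"] cong: if_cong)
  have "(\<lambda>n. if n \<in> insert k F then \<theta> n else 0) =
      (\<lambda>n. \<theta> k * (if n = k then 1 else 0) + (if n \<in> F then \<theta> n else 0))"
    using insert(2) by auto
  then show ?case
    using c0[of "insert k F" \<theta>] insert T(1)[OF ke c0[of F \<theta>]] T(2)[OF e, of "\<theta> k"] by simp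
qed

subsection \<open>Uniform boundedness\<close>

lemma dual_space_closed:
  assumes "\<And>n. f n \<in> dual_space sc" "f \<longlonglongrightarrow> g"
  shows "g \<in> dual_space sc"
  unfolding dual_space_iff
proof (intro allI)
  fix c x
  have *: "(\<lambda>n. blinfun_apply (f n) z) \<longlonglongrightarrow> blinfun_apply g z" for z
    by (rule bounded_linear.tendsto[OF blinfun.bounded_linear_left assms(2)])
  have "(\<lambda>n. blinfun_apply (f n) (sc c x)) \<longlonglongrightarrow> c * blinfun_apply g x"
    using assms(1) tendsto_mult_left[OF *[of x], of c] by (simp add: dual_space_iff)
  then show "blinfun_apply g (sc c x) = c * blinfun_apply g x"
    using *[of "sc c x"] LIMSEQ_unique by blast
qed

lemma dual_space_add: "f \<in> dual_space sc \<Longrightarrow> g \<in> dual_space sc \<Longrightarrow> f + g \<in> dual_space sc"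
  by (simp add: dual_space_iff blinfun.add_left algebra_simps)

lemma dual_space_scale: "f \<in> dual_space sc \<Longrightarrow> dual_scale c f \<in> dual_space sc"
  by (simp add: dual_space_iff algebra_simps)

lemma dual_space_scaleR: "f \<in> dual_space sc \<Longrightarrow> r *\<^sub>R f \<in> dual_space sc"
  by (simp add: dual_space_iff blinfun.scaleR_left)

lemma dual_space_0: "0 \<in> dual_space sc"
  by (simp add: dual_space_iff)

lemma dual_space_sum: "(\<And>i. i \<in> F \<Longrightarrow> f i \<in> dual_space sc) \<Longrightarrow> (\<Sum>i\<in>F. f i) \<in> dual_space sc"
  by (induction F rule: infinite_finite_induct) (auto intro: dual_space_add dual_space_0)

text \<open>Adding \<open>\<plusminus>3\<^sup>-\<^sup>n g\<close> with a norming functional \<open>g\<close> of a vector of norm at least \<open>4\<^sup>n\<close>, the sign being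
  chosen so that no cancellation occurs, produces a functional that is unbounded on the sequence.\<close>

lemma (in normed_space_over) weakly_bounded_imp_bounded:
  assumes "\<And>y. y \<in> dual_space sc \<Longrightarrow> \<exists>K. \<forall>k. norm (blinfun_apply y (x k)) \<le> K"
  shows "\<exists>K. \<forall>k. norm (x k) \<le> K"
proof (rule ccontr)
  assume "\<not> ?thesis"
  then have "\<exists>k. norm (x k) \<ge> 4 ^ n" for n :: nat
    by (meson linear)
  then obtain k where k: "norm (x (k n)) \<ge> 4 ^ n" for n :: nat
    by metis
  define z where "z = (\<lambda>n. x (k n))"
  have "\<exists>g\<in>dual_space sc. norm g \<le> 1 \<and> norm (blinfun_apply g (z n)) = norm (z n)" for n
    using norming_functional by metis
  then obtain g where g: "\<And>n. g n \<in> dual_space sc" "\<And>n. norm (g n) \<le> 1"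
    "\<And>n. norm (blinfun_apply (g n) (z n)) = norm (z n)"
    by metis
  \<comment> \<open>With ratio 1/3 all corrections after step \<open>n\<close> add up to at most
    half of the \<open>n\<close>-th one, and \<open>4 ^ n\<close> outgrows \<open>3 ^ n\<close>, so
    at least \<open>(1/2) * (4/3) ^ n\<close> survives at \<open>z n\<close>.\<close>
  define h where "h = (\<lambda>n. (1/3) ^ n *\<^sub>R g n)"
  have h: "h n \<in> dual_space sc" "norm (h n) \<le> (1/3) ^ n"
    "norm (blinfun_apply (h n) (z n)) = (1/3) ^ n * norm (z n)" for n
    using g by (simp_all add: h_def dual_space_scaleR blinfun.scaleR_left)
  define Y where "Y = rec_nat 0 (\<lambda>n y. if norm (blinfun_apply (y + h n) (z n)) \<ge> norm (blinfun_apply (h n) (z n))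
    then y + h n else y - h n)"
  have Y0: "Y 0 = 0" and YS: "Y (Suc n) = (if norm (blinfun_apply (Y n + h n) (z n)) \<ge> norm (blinfun_apply (h n) (z n))
    then Y n + h n else Y n - h n)" for n
    by (simp_all add: Y_def)
  have large: "norm (blinfun_apply (Y (Suc n)) (z n)) \<ge> (1/3) ^ n * norm (z n)" for n
  proof -
    \<comment> \<open>The values of the two candidates differ by twice the value of
      \<open>h n\<close>, so at least one of them is as large as that value.\<close>
    have "norm (blinfun_apply (h n) (z n) + blinfun_apply (h n) (z n)) \<le>
        norm (blinfun_apply (Y n + h n) (z n)) + norm (blinfun_apply (Y n - h n) (z n))"
      using norm_triangle_ineq4[of "blinfun_apply (Y n + h n) (z n)" "blinfun_apply (Y n - h n) (z n)"]
      by (simp add: blinfun.bilinear_simps)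
    moreover have "norm (blinfun_apply (h n) (z n) + blinfun_apply (h n) (z n)) = 2 * norm (blinfun_apply (h n) (z n))"
      by (simp add: mult_2[symmetric] norm_mult)
    ultimately show ?thesis
      unfolding YS h(3)[symmetric] by (simp split: if_split)
  qed
  have Y_dual: "Y n \<in> dual_space sc" for n
  proof (induction n)
    case (Suc n)
    then show ?case
      using dual_space_add[OF Suc h(1)] dual_space_add[OF Suc dual_space_scaleR[OF h(1), of "- 1"]]
      by (simp add: YS)
  qed (simp add: Y0 dual_space_0)
  define D where "D = (\<lambda>n. Y (Suc n) - Y n)"
  have D_le: "norm (D n) \<le> (1/3) ^ n" for n
    using h(2)[of n] by (simp add: D_def YS)
  have Y_sum: "(\<Sum>i<n. D i) = Y n" for n
    using sum_lessThan_telescope[of Y n] by (simp add: D_def Y0)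
  have geo: "summable (\<lambda>i. (1/3) ^ (i + n) :: real)" "(\<Sum>i. (1/3) ^ (i + n) :: real) = (1/3) ^ n * (3/2)" for n
    using suminf_mult2[of "\<lambda>i. (1/3)^i :: real" "(1/3) ^ n"] suminf_geometric[of "1/3 :: real"]
      summable_mult2[of "\<lambda>i. (1/3)^i :: real" "(1/3) ^ n"]
    by (simp_all add: power_add summable_geometric)
  have sD: "summable D"
    by (rule summable_comparison_test'[OF geo(1)[of 0]]) (use D_le in simp)
  define y where "y = (\<Sum>i. D i)"
  have "Y \<longlonglongrightarrow> y"
    using summable_LIMSEQ[OF sD] by (simp add: Y_sum y_def)
  then have "y \<in> dual_space sc"
    using Y_dual by (rule dual_space_closed[rotated])
  then obtain K where K: "\<And>k. norm (blinfun_apply y (x k)) \<le> K"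
    using assms by blast
  have final: "(1/2) * (4/3) ^ n \<le> K" for n
  proof -
    have "norm (y - Y (Suc n)) \<le> (1/3) ^ Suc n * (3/2)"
    proof -
      have sn: "summable (\<lambda>i. norm (D (i + Suc n)))"
        by (rule summable_comparison_test'[OF geo(1)[of "Suc n"]]) (use D_le in \<open>simp del: power_Suc add_Suc_right\<close>)
      have "y - Y (Suc n) = (\<Sum>i. D (i + Suc n))"
        using suminf_minus_initial_segment[OF sD, of "Suc n"] by (simp add: y_def Y_sum del: sum.lessThan_Suc)
      also have "norm \<dots> \<le> (\<Sum>i. norm (D (i + Suc n)))"
        by (rule summable_norm[OF sn])
      also have "\<dots> \<le> (\<Sum>i. (1/3) ^ (i + Suc n))"
        by (rule suminf_le[OF D_le sn geo(1)])
      finally show ?thesis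
        by (simp only: geo(2))
    qed
    then have "norm (blinfun_apply (y - Y (Suc n)) (z n)) \<le> (1/2) * (1/3) ^ n * norm (z n)"
      by (intro order_trans[OF norm_blinfun mult_right_mono]) auto
    then have "norm (blinfun_apply y (z n)) \<ge> (1/2) * (1/3) ^ n * norm (z n)"
      using large[of n] norm_triangle_ineq2[of "blinfun_apply (Y (Suc n)) (z n)" "blinfun_apply y (z n)"]
        norm_minus_commute[of "blinfun_apply (Y (Suc n)) (z n)" "blinfun_apply y (z n)"]
      by (simp add: blinfun.diff_left)
    moreover have "(1/2) * (1/3) ^ n * norm (z n) \<ge> (1/2) * (1/3) ^ n * 4 ^ n"
      using k[of n] by (intro mult_left_mono) (auto simp: z_def)
    moreover have "(1/2) * (1/3) ^ n * 4 ^ n = (1/2) * (4/3 :: real) ^ n"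
      by (simp add: power_divide)
    ultimately have "(1/2) * (4/3) ^ n \<le> norm (blinfun_apply y (z n))"
      by linarith
    also have "\<dots> \<le> K"
      using K by (simp add: z_def)
    finally show ?thesis .
  qed
  moreover obtain n where "2 * K < (4/3) ^ n"
    using real_arch_pow[of "4/3"] by auto
  ultimately show False
    using final[of n] by linarith
qed

subsection \<open>Besselian frames\<close>

lemma not_summable_blocks:
  fixes f :: "nat \<Rightarrow> 'v::banach"
  assumes "\<not> summable f"
  obtains \<delta> F where "\<delta> > 0" "\<And>i::nat. finite (F i)" "disjoint_family F" "\<And>i. norm (sum f (F i)) \<ge> \<delta>"
proof -
  obtain \<delta> where \<delta>: "\<delta> > 0" "\<And>N. \<exists>m\<ge>N. \<exists>n. norm (sum f {m..<n}) \<ge> \<delta>"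
    using assms unfolding summable_Cauchy by (meson not_less)
  have blocks: "\<exists>F k. finite F \<and> F \<subseteq> {N..} \<and> k \<ge> N \<and> norm (sum f F) \<ge> \<delta>" for N
  proof -
    obtain m n where "m \<ge> N" "norm (sum f {m..<n}) \<ge> \<delta>"
      using \<delta>(2) by blast
    then show ?thesis
      by (intro exI[of _ "{m..<n}"] exI[of _ N]) auto
  qed
  then show ?thesis
    using disjoint_blocks[of "\<lambda>F _. norm (sum f F) \<ge> \<delta>", OF blocks] that \<delta>(1) by blast
qed

lemma sum_blocks_le:
  fixes g :: "nat \<Rightarrow> real"
  assumes "\<And>G. finite G \<Longrightarrow> sum g G \<le> K" "\<And>i::nat. finite (F i)" "disjoint_family F" "finite J"
  shows "(\<Sum>j\<in>J. sum g (F j)) \<le> K"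
proof -
  have "(\<Sum>j\<in>J. sum g (F j)) = sum g (\<Union>j\<in>J. F j)"
    using assms(2-4) by (subst sum.UNION_disjoint) (auto simp: disjoint_family_on_def)
  also have "\<dots> \<le> K"
    using assms(2,4) by (intro assms(1)) auto
  finally show ?thesis .
qed

lemma sum_norm_blocks_le:
  fixes g :: "nat \<Rightarrow> 'v::real_normed_vector"
  assumes "\<And>G. finite G \<Longrightarrow> (\<Sum>n\<in>G. norm (g n)) \<le> K" "\<And>i::nat. finite (F i)" "disjoint_family F" "finite J"
  shows "(\<Sum>j\<in>J. norm (\<Sum>n\<in>F j. g n)) \<le> K"
proof -
  have "(\<Sum>j\<in>J. norm (\<Sum>n\<in>F j. g n)) \<le> (\<Sum>j\<in>J. \<Sum>n\<in>F j. norm (g n))"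
    by (intro sum_mono norm_sum)
  also have "\<dots> \<le> K"
    by (rule sum_blocks_le[of "\<lambda>n. norm (g n)"]) (use assms in auto)
  finally show ?thesis .
qed

text \<open>Rosenthal's lemma yields an injective selection that need not be increasing. It still
  tends to infinity, which is enough to pass to limits along it.\<close>

lemma filterlim_inj_nat:
  fixes f :: "nat \<Rightarrow> nat"
  assumes "inj f"
  shows "filterlim f at_top sequentially"
  unfolding filterlim_at_top
proof
  fix Z
  have "finite (f -` {..<Z})"
    using assms by (intro finite_vimageI) auto
  then show "\<forall>\<^sub>F n in sequentially. Z \<le> f n"
    unfolding cofinite_eq_sequentially[symmetric] eventually_cofinite
    by (rule rev_finite_subset) auto
qed

locale besselian_frame = normed_space_over sc
  for sc :: "'k::real_or_complex \<Rightarrow> 'e::banach \<Rightarrow> 'e" +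
  fixes a :: "nat \<Rightarrow> 'e" and b :: "nat \<Rightarrow> 'e \<Rightarrow>\<^sub>L 'k" and B :: real
  assumes frame: "schauder_frame sc UNIV a (\<lambda>n. blinfun_apply (b n))"
    and B_pos: "B > 0"
    and bessel: "y \<in> dual_space sc \<Longrightarrow>
      summable (\<lambda>n. norm (blinfun_apply (b n) x) * norm (blinfun_apply y (a n)))"
      "y \<in> dual_space sc \<Longrightarrow>
      (\<Sum>n. norm (blinfun_apply (b n) x) * norm (blinfun_apply y (a n))) \<le> B * norm x * norm y"
begin

lemma b_dual: "b n \<in> dual_space sc"
  using frame by (auto simp: schauder_frame_def dual_space_def)

lemma expansion: "(\<lambda>n. sc (blinfun_apply (b n) x) (a n)) sums x"
  using frame by (auto simp: schauder_frame_def)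

lemma dual_expansion:
  "y \<in> dual_space sc \<Longrightarrow> (\<lambda>n. blinfun_apply (b n) x * blinfun_apply y (a n)) sums blinfun_apply y x"
  using bounded_linear.sums[OF blinfun.bounded_linear_right expansion, of y x] by (simp add: dual_sc)

lemma bessel_sum:
  assumes "y \<in> dual_space sc"
  shows "(\<Sum>n\<in>F. norm (blinfun_apply (b n) x * blinfun_apply y (a n))) \<le> B * norm x * norm y"
proof (cases "finite F")
  case True
  then show ?thesis
    using order_trans[OF sum_le_suminf[OF bessel(1)[OF assms] True] bessel(2)[OF assms]]
    by (simp add: norm_mult)
next
  case False
  then show ?thesis
    using B_pos by simp
qed

lemma bessel_summable:
  "y \<in> dual_space sc \<Longrightarrow> summable (\<lambda>n. norm (blinfun_apply (b n) x * blinfun_apply y (a n)))"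
  using bessel(1) by (simp add: norm_mult)

text \<open>A bidual element is known to be linear only on \<open>dual_space sc\<close>, so
  membership of the summands and of the partial sums has to be carried through the
  induction.\<close>

lemma functional_dual_sum:
  assumes "\<phi> \<in> continuous_functionals dual_scale (dual_space sc)" "\<And>i. i \<in> F \<Longrightarrow> f i \<in> dual_space sc"
  shows "\<phi> (\<Sum>i\<in>F. dual_scale (c i) (f i)) = (\<Sum>i\<in>F. c i * \<phi> (f i))"
  using assms(2)
proof (induction F rule: infinite_finite_induct)
  case (insert i F)
  then show ?case
    using assms(1) by (simp add: continuous_functionals_def dual_space_scale dual_space_sum)
next
  have "\<phi> (dual_scale 0 0) = 0 * \<phi> 0"
    using assms(1) dual_space_0[of sc] unfolding continuous_functionals_def by blast
  moreover have "dual_scale 0 0 = (0 :: 'e \<Rightarrow>\<^sub>L 'k)"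
    by (intro blinfun_eqI) simp
  ultimately have "\<phi> 0 = 0"
    by simp
  then show "\<phi> (\<Sum>i\<in>F. dual_scale (c i) (f i)) = (\<Sum>i\<in>F. c i * \<phi> (f i))" if "infinite F" for F
    using that by simp
  show "\<phi> (\<Sum>i\<in>{}. dual_scale (c i) (f i)) = (\<Sum>i\<in>{}. c i * \<phi> (f i))"
    using \<open>\<phi> 0 = 0\<close> by simp
qed

text \<open>If the dual series converges in norm at all, its sum is \<open>y\<close>, since
  evaluating it at \<open>x\<close> gives the frame expansion of \<open>y\<close> at
  \<open>x\<close>. Thus only convergence can fail.\<close>

lemma shrinking_iff:
  "shrinking sc a b \<longleftrightarrow> (\<forall>y\<in>dual_space sc. summable (\<lambda>n. dual_scale (blinfun_apply y (a n)) (b n)))"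
proof
  assume "shrinking sc a b"
  then show "\<forall>y\<in>dual_space sc. summable (\<lambda>n. dual_scale (blinfun_apply y (a n)) (b n))"
    unfolding shrinking_def schauder_frame_def canonical_embedding_def by (blast intro: sums_summable)
next
  assume *: "\<forall>y\<in>dual_space sc. summable (\<lambda>n. dual_scale (blinfun_apply y (a n)) (b n))"
  have "(\<lambda>n. dual_scale (blinfun_apply y (a n)) (b n)) sums y" if y: "y \<in> dual_space sc" for y
  proof -
    have sums: "(\<lambda>n. dual_scale (blinfun_apply y (a n)) (b n)) sums (\<Sum>n. dual_scale (blinfun_apply y (a n)) (b n))"
      using * y by (auto intro: summable_sums)
    have "(\<Sum>n. dual_scale (blinfun_apply y (a n)) (b n)) = y"
    proof (rule blinfun_eqI)
      fix x
      show "blinfun_apply (\<Sum>n. dual_scale (blinfun_apply y (a n)) (b n)) x = blinfun_apply y x"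
        using bounded_linear.sums[OF blinfun.bounded_linear_left sums, of x] dual_expansion[OF y, of x]
        by (simp add: mult.commute sums_unique2)
    qed
    then show ?thesis
      using sums by simp
  qed
  moreover have "(\<lambda>f. blinfun_apply f x) \<in> continuous_functionals dual_scale (dual_space sc)" for x
    using norm_blinfun[of _ x]
    by (auto simp: continuous_functionals_def blinfun.add_left mult.commute intro!: exI[of _ "norm x"])
  ultimately show "shrinking sc a b"
    using b_dual by (auto simp: shrinking_def schauder_frame_def canonical_embedding_def)
qed

section \<open>Copies of \<open>l_1\<close> and \<open>c_0\<close> from divergent series\<close>

text \<open>The blocks \<open>u i\<close> of the divergent dual series serve as coordinate
  functionals, and vectors that almost norm them as the basis. The norm of a functional need not be
  attained, so the diagonal bound drops from \<open>\<delta>\<close> to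
  \<open>\<delta> / 2\<close>.\<close>

lemma exists_l1_if_not_shrinking:
  assumes "\<not> shrinking sc a b"
  shows "has_subspace_isomorphic_to sc l1_space l1_norm"
proof -
  obtain y where y: "y \<in> dual_space sc" "\<not> summable (\<lambda>n. dual_scale (blinfun_apply y (a n)) (b n))"
    using assms by (auto simp: shrinking_iff)
  obtain \<delta> F where \<delta>: "\<delta> > 0" and F: "\<And>i::nat. finite (F i)" "disjoint_family F"
    "\<And>i. norm (\<Sum>n\<in>F i. dual_scale (blinfun_apply y (a n)) (b n)) \<ge> \<delta>"
    using not_summable_blocks[OF y(2)] by metis
  define u where "u = (\<lambda>i. \<Sum>n\<in>F i. dual_scale (blinfun_apply y (a n)) (b n))"
  have u_dual: "u i \<in> dual_space sc" for i
    unfolding u_def by (intro dual_space_sum dual_space_scale b_dual)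
  have u_apply: "blinfun_apply (u i) z = (\<Sum>n\<in>F i. blinfun_apply (b n) z * blinfun_apply y (a n))" for i z
    by (simp add: u_def blinfun.sum_left mult.commute)
  have total: "(\<Sum>j\<in>J. norm (blinfun_apply (u j) z)) \<le> B * norm y * norm z" if "finite J" for J z
    unfolding u_apply using sum_norm_blocks_le[OF bessel_sum[OF y(1)] F(1,2) that]
    by (simp add: mult.assoc mult.commute[of "norm y"])
  have "\<exists>x. norm x \<le> 1 \<and> norm (blinfun_apply (u i) x) \<ge> \<delta> / 2" for i
  proof -
    have "\<exists>x. norm (blinfun_apply (u i) x) > \<delta> / 2 * norm x"
    proof (rule ccontr)
      assume "\<not> ?thesis"
      then have "norm (u i) \<le> \<delta> / 2"
        using \<delta> by (intro norm_blinfun_bound) (auto simp: not_less)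
      then show False
        using F(3)[of i] \<delta> by (simp add: u_def)
    qed
    then obtain x where x: "norm (blinfun_apply (u i) x) > \<delta> / 2 * norm x"
      by blast
    then have "x \<noteq> 0"
      by (auto simp: blinfun.zero_right)
    with x show ?thesis
      by (intro exI[of _ "x /\<^sub>R norm x"]) (simp add: blinfun.scaleR_right field_simps)
  qed
  then obtain x where x: "\<And>i. norm (x i) \<le> 1" "\<And>i. norm (blinfun_apply (u i) (x i)) \<ge> \<delta> / 2"
    by metis
  have row: "(\<Sum>j\<in>J. norm (blinfun_apply (u j) (x k))) \<le> B * norm y" if "finite J" for J k
  proof -
    have "B * norm y * norm (x k) \<le> B * norm y * 1"
      by (intro mult_left_mono x(1)) (use B_pos in simp)
    then show ?thesis
      using total[OF that, of "x k"] by linarith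
  qed
  \<comment> \<open>One factor 1/2 was lost in norming the blocks; the other is the ratio of
    off-diagonal to diagonal terms required by \<open>l1_subspaceI\<close>.\<close>
  have "\<delta> / 2 / 2 > 0"
    using \<delta> by simp
  then obtain r :: "nat \<Rightarrow> nat" where r: "inj r"
    "\<And>k J. finite J \<Longrightarrow> k \<notin> J \<Longrightarrow> (\<Sum>j\<in>J. norm (blinfun_apply (u (r j)) (x (r k)))) \<le> \<delta> / 2 / 2"
    using rosenthal_lemma[of "\<delta> / 2 / 2" "\<lambda>k j. norm (blinfun_apply (u j) (x k))", OF _ _ row] by auto
  show ?thesis
  proof (rule l1_subspaceI[of sc "\<lambda>k. x (r k)" "\<lambda>k. u (r k)" "\<delta> / 2" "B * norm y"])
    show "(\<Sum>j\<in>J. norm (blinfun_apply (u (r j)) z)) \<le> B * norm y * norm z" if "finite J" for J z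
      using total[of "r ` J" z] that inj_on_subset[OF r(1), of J] by (simp add: sum.reindex)
  qed (use normed_space_over_axioms x u_dual r \<delta> in auto)
qed

text \<open>The roles are exchanged: the blocks \<open>v i\<close> are vectors, and the test objects
  are functionals. By Hahn--Banach these norm the blocks exactly, so no factor is lost on the
  diagonal.\<close>

lemma exists_c0_if_not_boundedly_complete:
  assumes "\<not> boundedly_complete sc a b"
  shows "has_subspace_isomorphic_to sc c0_space sup_norm"
proof -
  obtain \<phi> where \<phi>: "\<phi> \<in> continuous_functionals dual_scale (dual_space sc)"
    "\<not> summable (\<lambda>n. sc (\<phi> (b n)) (a n))"
    using assms by (auto simp: boundedly_complete_def)
  obtain K0 where "\<And>f. f \<in> dual_space sc \<Longrightarrow> norm (\<phi> f) \<le> K0 * norm f"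
    using \<phi>(1) unfolding continuous_functionals_def by blast
  then have K: "norm (\<phi> f) \<le> \<bar>K0\<bar> * norm f" if "f \<in> dual_space sc" for f
    using that by (meson abs_ge_self mult_right_mono norm_ge_zero order_trans)
  \<comment> \<open>The Besselian estimate is lifted to the bidual. With suitable phases the finite
    sum is the value of \<open>\<phi>\<close> at one functional \<open>g\<close>, and the original
    estimate bounds the norm of \<open>g\<close> by \<open>B * norm y\<close>.\<close>
  have \<phi>_bessel: "(\<Sum>n\<in>G. norm (\<phi> (b n) * blinfun_apply y (a n))) \<le> \<bar>K0\<bar> * B * norm y"
    if y: "y \<in> dual_space sc" for G y
  proof -
    obtain \<theta> where \<theta>: "\<And>n. norm (\<theta> n) = 1"
      "\<And>n. \<theta> n * (\<phi> (b n) * blinfun_apply y (a n)) = of_real (norm (\<phi> (b n) * blinfun_apply y (a n)))"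
      using real_or_complex_phases[of "\<lambda>n. \<phi> (b n) * blinfun_apply y (a n)"] by blast
    define g where "g = (\<Sum>n\<in>G. dual_scale (\<theta> n * blinfun_apply y (a n)) (b n))"
    have g: "g \<in> dual_space sc"
      unfolding g_def by (intro dual_space_sum dual_space_scale b_dual)
    have "norm g \<le> B * norm y"
    proof (rule norm_blinfun_bound)
      fix x
      have "norm (blinfun_apply g x) \<le> (\<Sum>n\<in>G. norm (blinfun_apply (b n) x * blinfun_apply y (a n)))"
        unfolding g_def blinfun.sum_left by (rule sum_norm_le) (simp add: norm_mult \<theta>)
      also have "\<dots> \<le> B * norm x * norm y"
        by (rule bessel_sum[OF y])
      finally show "norm (blinfun_apply g x) \<le> B * norm y * norm x"
        by (simp add: mult_ac)
    qed (use B_pos in simp)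
    have "\<phi> g = (\<Sum>n\<in>G. of_real (norm (\<phi> (b n) * blinfun_apply y (a n))))"
      unfolding g_def functional_dual_sum[OF \<phi>(1) b_dual] by (simp only: \<theta>(2)[symmetric] mult_ac)
    then have "(\<Sum>n\<in>G. norm (\<phi> (b n) * blinfun_apply y (a n))) = norm (\<phi> g)"
      by (simp only: of_real_sum[symmetric] norm_of_real abs_of_nonneg sum_nonneg norm_ge_zero)
    also have "\<dots> \<le> \<bar>K0\<bar> * (B * norm y)"
      using K[OF g] mult_left_mono[OF \<open>norm g \<le> B * norm y\<close>, of "\<bar>K0\<bar>"] by linarith
    finally show ?thesis
      by (simp add: mult.assoc)
  qed
  obtain \<delta> F where \<delta>: "\<delta> > 0" and F: "\<And>i::nat. finite (F i)" "disjoint_family F"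
    "\<And>i. norm (\<Sum>n\<in>F i. sc (\<phi> (b n)) (a n)) \<ge> \<delta>"
    using not_summable_blocks[OF \<phi>(2)] by metis
  define v where "v = (\<lambda>i. \<Sum>n\<in>F i. sc (\<phi> (b n)) (a n))"
  have v_apply: "blinfun_apply y (v i) = (\<Sum>n\<in>F i. \<phi> (b n) * blinfun_apply y (a n))"
    if "y \<in> dual_space sc" for y i
    by (simp add: v_def dual_sum_sc[OF that])
  have total: "(\<Sum>j\<in>J. norm (blinfun_apply y (v j))) \<le> \<bar>K0\<bar> * B * norm y"
    if "finite J" "y \<in> dual_space sc" for J y
    unfolding v_apply[OF that(2)] using \<phi>_bessel[OF that(2)] F(1,2) that(1)
    by (intro sum_norm_blocks_le) auto
  have "\<exists>f\<in>dual_space sc. norm f \<le> 1 \<and> norm (blinfun_apply f (v i)) = norm (v i)" for i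
    using norming_functional by metis
  then obtain f where f: "\<And>i. f i \<in> dual_space sc" "\<And>i. norm (f i) \<le> 1"
    "\<And>i. norm (blinfun_apply (f i) (v i)) = norm (v i)"
    by metis
  have row: "(\<Sum>j\<in>J. norm (blinfun_apply (f k) (v j))) \<le> \<bar>K0\<bar> * B" if "finite J" for J k
  proof -
    have "\<bar>K0\<bar> * B * norm (f k) \<le> \<bar>K0\<bar> * B * 1"
      by (intro mult_left_mono f(2)) (use B_pos in simp)
    then show ?thesis
      using total[OF that f(1), of k] by linarith
  qed
  have "\<delta> / 2 > 0"
    using \<delta> by simp
  then obtain r :: "nat \<Rightarrow> nat" where r: "inj r"
    "\<And>k J. finite J \<Longrightarrow> k \<notin> J \<Longrightarrow> (\<Sum>j\<in>J. norm (blinfun_apply (f (r k)) (v (r j)))) \<le> \<delta> / 2"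
    using rosenthal_lemma[of "\<delta> / 2" "\<lambda>k j. norm (blinfun_apply (f k) (v j))", OF _ _ row] by auto
  show ?thesis
  proof (rule c0_subspaceI[of sc "\<lambda>k. f (r k)" \<delta> "\<lambda>k. v (r k)" "\<bar>K0\<bar> * B"])
    show "(\<Sum>j\<in>J. norm (blinfun_apply y (v (r j)))) \<le> \<bar>K0\<bar> * B * norm y"
      if "y \<in> dual_space sc" "finite J" for J y
      using total[of "r ` J" y] that inj_on_subset[OF r(1), of J] by (simp add: sum.reindex)
    show "norm (blinfun_apply (f (r k)) (v (r k))) \<ge> \<delta>" for k
      using F(3)[of "r k"] by (simp add: f(3)) (simp add: v_def)
  qed (use normed_space_over_axioms f r \<delta> B_pos in auto)
qed

section \<open>Weakly Cauchy sequences\<close>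

text \<open>The expansion of \<open>y\<close> converges absolutely at every vector, so it may be
  restricted to an arbitrary, even infinite, set of indices and still defines a functional of norm
  at most \<open>B * norm y\<close>.\<close>

lemma restricted_functional:
  assumes y: "y \<in> dual_space sc"
  obtains u where "u \<in> dual_space sc"
    "\<And>x. blinfun_apply u x = (\<Sum>n. if n \<in> A then blinfun_apply (b n) x * blinfun_apply y (a n) else 0)"
proof -
  define f where "f = (\<lambda>x n. if n \<in> A then blinfun_apply (b n) x * blinfun_apply y (a n) else 0)"
  have sn: "summable (\<lambda>n. norm (f x n))" for x
    by (rule summable_comparison_test'[OF bessel_summable[OF y, of x], of 0]) (simp add: f_def)
  note s = summable_norm_cancel[OF sn]
  have add: "f (x + z) = (\<lambda>n. f x n + f z n)" for x z
    by (auto simp: f_def blinfun.add_right algebra_simps)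
  have scl: "f (sc c x) = (\<lambda>n. c * f x n)" for c x
    by (auto simp: f_def dual_sc[OF b_dual])
  have "norm (suminf (f x)) \<le> (B * norm y) * norm x" for x
  proof -
    have "norm (suminf (f x)) \<le> (\<Sum>n. norm (f x n))"
      by (rule summable_norm[OF sn])
    also have "\<dots> \<le> (\<Sum>n. norm (blinfun_apply (b n) x * blinfun_apply y (a n)))"
      by (rule suminf_le[OF _ sn bessel_summable[OF y]]) (simp add: f_def)
    also have "\<dots> \<le> B * norm x * norm y"
      using bessel(2)[OF y, of x] by (simp add: norm_mult)
    finally show ?thesis
      by (simp add: mult_ac)
  qed
  moreover have "suminf (f (x + z)) = suminf (f x) + suminf (f z)" for x z
    unfolding add by (rule suminf_add[OF s s, symmetric])
  moreover have "suminf (f (sc c x)) = c * suminf (f x)" for c x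
    unfolding scl by (rule suminf_mult[OF s])
  ultimately have "Blinfun (\<lambda>x. suminf (f x)) \<in> dual_space sc"
    "blinfun_apply (Blinfun (\<lambda>x. suminf (f x))) = (\<lambda>x. suminf (f x))"
    using continuous_functional_in_dual[of "\<lambda>x. suminf (f x)" "B * norm y"] by blast+
  then show ?thesis
    using that by (simp add: f_def)
qed

text \<open>Along a weakly Cauchy sequence the expansions of a fixed functional have uniformly small tails:
  otherwise Rosenthal's lemma gives disjoint blocks \<open>F (r i)\<close>, nearly independent of each other, and
  summing over the blocks of even index yields a functional that does not converge on the sequence.\<close>

lemma weakly_Cauchy_tails:
  assumes conv: "\<And>y. y \<in> dual_space sc \<Longrightarrow> convergent (\<lambda>k. blinfun_apply y (x k))"
    and y: "y \<in> dual_space sc" and \<epsilon>: "\<epsilon> > 0" and C: "\<And>k. norm (x k) \<le> C"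
  shows "\<exists>N\<ge>N0. \<forall>k\<ge>N. norm (blinfun_apply y (x k) -
    (\<Sum>n<N. blinfun_apply (b n) (x k) * blinfun_apply y (a n))) \<le> \<epsilon>"
proof (rule ccontr)
  define z where "z = (\<lambda>k n. blinfun_apply (b n) (x k) * blinfun_apply y (a n))"
  assume "\<not> ?thesis"
  then have neg: "\<exists>k\<ge>N. norm (blinfun_apply y (x k) - (\<Sum>n<N. z k n)) > \<epsilon>" if "N \<ge> N0" for N
    using that unfolding z_def by (meson not_le)
  have blocks: "\<exists>F k. finite F \<and> F \<subseteq> {N..} \<and> k \<ge> N \<and> norm (\<Sum>n\<in>F. z k n) > \<epsilon>" for N
  proof -
    obtain k where k: "k \<ge> max N N0"
      "norm (blinfun_apply y (x k) - (\<Sum>n<max N N0. z k n)) > \<epsilon>"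
      using neg[of "max N N0"] by auto
    \<comment> \<open>The tail exceeds \<open>\<epsilon>\<close> strictly, so a finite piece of it
      already does.\<close>
    have "(\<lambda>M. norm ((\<Sum>n<M. z k n) - (\<Sum>n<max N N0. z k n))) \<longlonglongrightarrow>
        norm (blinfun_apply y (x k) - (\<Sum>n<max N N0. z k n))"
      using dual_expansion[OF y, of "x k"] by (intro tendsto_intros) (simp add: z_def sums_def)
    then have "\<forall>\<^sub>F M in sequentially. norm ((\<Sum>n<M. z k n) - (\<Sum>n<max N N0. z k n)) > \<epsilon>"
      using k(2) by (rule order_tendstoD(1))
    then obtain M where M: "M \<ge> max N N0" "norm ((\<Sum>n<M. z k n) - (\<Sum>n<max N N0. z k n)) > \<epsilon>"
      unfolding eventually_sequentially by (meson linear order_refl)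
    have "(\<Sum>n<M. z k n) - (\<Sum>n<max N N0. z k n) = (\<Sum>n\<in>{max N N0..<M}. z k n)"
      using sum_diff_nat_ivl[of 0 "max N N0" M "z k"] M(1) by (simp add: atLeast0LessThan)
    with M k(1) show ?thesis
      by (intro exI[of _ "{max N N0..<M}"] exI[of _ k]) auto
  qed
  obtain F :: "nat \<Rightarrow> nat set" and k where F: "\<And>i. finite (F i)" "disjoint_family F"
    and k: "strict_mono k" and large: "\<And>i. norm (\<Sum>n\<in>F i. z (k i) n) > \<epsilon>"
    using disjoint_blocks[of "\<lambda>F k. norm (\<Sum>n\<in>F. z k n) > \<epsilon>", OF blocks] by blast
  have z_sum: "(\<Sum>n\<in>G. norm (z j n)) \<le> B * C * norm y" for G j
  proof -
    have "(\<Sum>n\<in>G. norm (z j n)) \<le> B * norm (x j) * norm y"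
      unfolding z_def by (rule bessel_sum[OF y])
    also have "\<dots> \<le> B * C * norm y"
      using C[of j] B_pos by (intro mult_right_mono mult_left_mono) auto
    finally show ?thesis .
  qed
  have row: "(\<Sum>j\<in>J. \<Sum>n\<in>F j. norm (z (k i) n)) \<le> B * C * norm y" if "finite J" for J i
    by (rule sum_blocks_le[of "\<lambda>n. norm (z (k i) n)"]) (use z_sum F that in auto)
  \<comment> \<open>The selected vectors of even index will have values of modulus at least
    \<open>\<epsilon> - \<epsilon> / 4\<close>, those of odd index at most
    \<open>\<epsilon> / 4\<close>; any bound below \<open>\<epsilon> / 2\<close> would separate
    them.\<close>
  have "\<epsilon> / 4 > 0"
    using \<epsilon> by simp
  then obtain r :: "nat \<Rightarrow> nat" where r: "inj r"
    "\<And>i J. finite J \<Longrightarrow> i \<notin> J \<Longrightarrow> (\<Sum>j\<in>J. \<Sum>n\<in>F (r j). norm (z (k (r i)) n)) \<le> \<epsilon> / 4"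
    using rosenthal_lemma[of "\<epsilon> / 4" "\<lambda>i j. \<Sum>n\<in>F j. norm (z (k i) n)", OF _ _ row]
    by (auto simp: sum_nonneg)
  define A where "A = (\<Union>i. F (r (2 * i)))"
  obtain u where u: "u \<in> dual_space sc"
    "\<And>v. blinfun_apply u v = (\<Sum>n. if n \<in> A then blinfun_apply (b n) v * blinfun_apply y (a n) else 0)"
    using restricted_functional[OF y] by blast
  have u_x: "blinfun_apply u (x j) = (\<Sum>n. if n \<in> A then z j n else 0)" for j
    by (simp only: u z_def)
  have disj: "n \<notin> F (r j)" if "n \<in> F (r i)" "i \<noteq> j" for n i j
  proof -
    have "r i \<noteq> r j"
      using that(2) r(1) by (auto dest: injD)
    then have "F (r i) \<inter> F (r j) = {}"
      using F(2) by (simp add: disjoint_family_on_def)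
    then show ?thesis
      using that(1) by blast
  qed
  have small: "summable (\<lambda>n. if n \<in> A - F (r i) then z (k (r i)) n else 0)"
    "norm (\<Sum>n. if n \<in> A - F (r i) then z (k (r i)) n else 0) \<le> \<epsilon> / 4" for i
  proof -
    define g where "g = (\<lambda>n. if n \<in> A - F (r i) then z (k (r i)) n else 0)"
    have g_sum: "(\<Sum>n<m. norm (g n)) \<le> \<epsilon> / 4" for m
    proof -
      let ?S = "{..<m} \<inter> (A - F (r i))"
      \<comment> \<open>The finitely many indices in \<open>?S\<close> meet only finitely many
        blocks, none of them the \<open>i\<close>-th, so the selection bound applies to their
        union.\<close>
      have "\<forall>n\<in>?S. \<exists>j. j \<noteq> i \<and> n \<in> F (r j)"
        by (auto simp: A_def)
      then obtain h where h: "\<And>n. n \<in> ?S \<Longrightarrow> h n \<noteq> i \<and> n \<in> F (r (h n))"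
        by metis
      have "(\<Sum>n<m. norm (g n)) = (\<Sum>n\<in>?S. norm (z (k (r i)) n))"
        by (simp add: g_def if_distrib[of norm] sum.inter_restrict cong: if_cong)
      also have "\<dots> \<le> (\<Sum>n\<in>(\<Union>j\<in>h ` ?S. F (r j)). norm (z (k (r i)) n))"
        using h F(1) by (intro sum_mono2) auto
      also have "\<dots> = (\<Sum>j\<in>h ` ?S. \<Sum>n\<in>F (r j). norm (z (k (r i)) n))"
        using F(1) disj by (intro sum.UNION_disjoint) auto
      also have "\<dots> \<le> \<epsilon> / 4"
        using h by (intro r(2)) auto
      finally show ?thesis .
    qed
    have sg: "summable (\<lambda>n. norm (g n))"
      by (rule summableI_nonneg_bounded[OF _ g_sum]) simp
    show "summable (\<lambda>n. if n \<in> A - F (r i) then z (k (r i)) n else 0)"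
      using summable_norm_cancel[OF sg] by (simp add: g_def)
    have "norm (suminf g) \<le> (\<Sum>n. norm (g n))"
      by (rule summable_norm[OF sg])
    also have "\<dots> \<le> \<epsilon> / 4"
      by (rule suminf_le_const[OF sg g_sum])
    finally show "norm (\<Sum>n. if n \<in> A - F (r i) then z (k (r i)) n else 0) \<le> \<epsilon> / 4"
      by (simp add: g_def)
  qed
  have odd: "norm (blinfun_apply u (x (k (r (2 * i + 1))))) \<le> \<epsilon> / 4" for i
  proof -
    have "n \<notin> F (r (2 * i + 1))" if n: "n \<in> A" for n
    proof -
      obtain i' where "n \<in> F (r (2 * i'))"
        using n by (auto simp: A_def)
      moreover have "2 * i' \<noteq> 2 * i + 1"
        by presburger
      ultimately show ?thesis
        by (rule disj)
    qed
    then have "A - F (r (2 * i + 1)) = A"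
      by blast
    with small(2)[of "2 * i + 1"] show ?thesis
      by (simp only: u_x)
  qed
  have even: "norm (blinfun_apply u (x (k (r (2 * i))))) \<ge> 3 * \<epsilon> / 4" for i
  proof -
    let ?z = "z (k (r (2 * i)))" and ?F = "F (r (2 * i))"
    have "?F \<subseteq> A"
      by (auto simp: A_def)
    then have "(\<lambda>n. if n \<in> A then ?z n else 0) =
        (\<lambda>n. (if n \<in> A - ?F then ?z n else 0) + (if n \<in> ?F then ?z n else 0))"
      by (auto simp: fun_eq_iff)
    moreover have "(\<lambda>n. if n \<in> ?F then ?z n else 0) sums (\<Sum>n\<in>?F. ?z n)"
      using F(1) by (rule sums_If_finite_set)
    ultimately have "(\<lambda>n. if n \<in> A then ?z n else 0) sums
        ((\<Sum>n. if n \<in> A - ?F then ?z n else 0) + (\<Sum>n\<in>?F. ?z n))"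
      using sums_add[OF summable_sums[OF small(1)[of "2 * i"]]] by simp
    then have "blinfun_apply u (x (k (r (2 * i)))) =
        (\<Sum>n. if n \<in> A - ?F then ?z n else 0) + (\<Sum>n\<in>?F. ?z n)"
      by (simp add: u_x sums_unique[symmetric])
    then show ?thesis
      using small(2)[of "2 * i"] large[of "r (2 * i)"]
        norm_diff_ineq[of "\<Sum>n\<in>?F. ?z n" "\<Sum>n. if n \<in> A - ?F then ?z n else 0"]
      by (simp add: add.commute)
  qed
  obtain L where L: "(\<lambda>j. blinfun_apply u (x j)) \<longlonglongrightarrow> L"
    using conv[OF u(1)] by (auto simp: convergent_def)
  have sub: "(\<lambda>i. norm (blinfun_apply u (x (k (r (g i)))))) \<longlonglongrightarrow> norm L" if "inj g" for g :: "nat \<Rightarrow> nat"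
  proof -
    have "inj (\<lambda>i. k (r (g i)))"
      using inj_compose[OF strict_mono_imp_inj_on[OF k] inj_compose[OF r(1) that]] by (simp add: o_def)
    from filterlim_compose[OF L filterlim_inj_nat[OF this]] show ?thesis
      by (rule tendsto_norm)
  qed
  have "inj (\<lambda>i::nat. 2 * i)" "inj (\<lambda>i::nat. 2 * i + 1)"
    by (auto simp: inj_on_def)
  note lims = this[THEN sub]
  have "3 * \<epsilon> / 4 \<le> norm L"
    by (rule LIMSEQ_le_const[OF lims(1)]) (use even in blast)
  moreover have "norm L \<le> \<epsilon> / 4"
    by (rule LIMSEQ_le_const2[OF lims(2)]) (use odd in blast)
  ultimately show False
    using \<epsilon> by simp
qed

text \<open>Uniform boundedness gives a common norm bound \<open>C\<close>, and the same
  \<open>C\<close> bounds the pointwise limit as a functional on the dual. Both are returned because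
  the tail estimate also needs \<open>C\<close>.\<close>

lemma weakly_Cauchy_limit:
  assumes conv: "\<And>y. y \<in> dual_space sc \<Longrightarrow> convergent (\<lambda>k. blinfun_apply y (x k))"
  obtains C where "\<And>k. norm (x k) \<le> C"
    "(\<lambda>y. lim (\<lambda>k. blinfun_apply y (x k))) \<in> continuous_functionals dual_scale (dual_space sc)"
proof -
  have "\<exists>K. \<forall>k. norm (blinfun_apply y (x k)) \<le> K" if "y \<in> dual_space sc" for y
    using convergent_imp_Bseq[OF conv[OF that]] by (auto simp: Bseq_def)
  then obtain C where C: "\<And>k. norm (x k) \<le> C"
    using weakly_bounded_imp_bounded by blast
  have lim: "(\<lambda>k. blinfun_apply y (x k)) \<longlonglongrightarrow> lim (\<lambda>k. blinfun_apply y (x k))"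
    if "y \<in> dual_space sc" for y
    using conv[OF that] by (simp add: convergent_LIMSEQ_iff)
  have "lim (\<lambda>k. blinfun_apply (f + g) (x k)) = lim (\<lambda>k. blinfun_apply f (x k)) + lim (\<lambda>k. blinfun_apply g (x k))"
    if "f \<in> dual_space sc" "g \<in> dual_space sc" for f g
    using tendsto_add[OF lim lim, OF that] by (auto simp: blinfun.add_left intro: limI)
  moreover have "lim (\<lambda>k. blinfun_apply (dual_scale c f) (x k)) = c * lim (\<lambda>k. blinfun_apply f (x k))"
    if "f \<in> dual_space sc" for c f
    using tendsto_mult_left[OF lim[OF that], of c] by (auto intro: limI)
  moreover have "norm (lim (\<lambda>k. blinfun_apply f (x k))) \<le> C * norm f" if "f \<in> dual_space sc" for f
  proof (rule LIMSEQ_le_const2[OF tendsto_norm[OF lim[OF that]]], intro exI allI impI)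
    show "norm (blinfun_apply f (x k)) \<le> C * norm f" for k
      using norm_blinfun[of f "x k"] mult_left_mono[OF C[of k], of "norm f"] by (simp add: mult.commute)
  qed
  ultimately have "(\<lambda>y. lim (\<lambda>k. blinfun_apply y (x k))) \<in> continuous_functionals dual_scale (dual_space sc)"
    unfolding continuous_functionals_def by blast
  with C show ?thesis
    using that by blast
qed

text \<open>The limit functional lies in the bidual, so bounded completeness provides the candidate
  \<open>l\<close>. The uniform tail estimate justifies exchanging limit and series: with the
  truncation \<open>N\<close> fixed, \<open>k\<close> tends to infinity.\<close>

lemma boundedly_complete_imp_weakly_sequentially_complete:
  assumes "boundedly_complete sc a b"
  shows "weakly_sequentially_complete sc"
  unfolding weakly_sequentially_complete_def
proof (intro allI impI)
  fix x :: "nat \<Rightarrow> 'e"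
  assume "\<forall>y\<in>dual_space sc. convergent (\<lambda>n. blinfun_apply y (x n))"
  then have conv: "convergent (\<lambda>n. blinfun_apply y (x n))" if "y \<in> dual_space sc" for y
    using that by blast
  define \<phi> where "\<phi> = (\<lambda>y :: 'e \<Rightarrow>\<^sub>L 'k. lim (\<lambda>k. blinfun_apply y (x k)))"
  obtain C where C: "\<And>k. norm (x k) \<le> C" and \<phi>: "\<phi> \<in> continuous_functionals dual_scale (dual_space sc)"
    unfolding \<phi>_def using weakly_Cauchy_limit[OF conv] by blast
  have lim: "(\<lambda>k. blinfun_apply y (x k)) \<longlonglongrightarrow> \<phi> y" if "y \<in> dual_space sc" for y
    using conv[OF that] by (simp add: convergent_LIMSEQ_iff \<phi>_def)
  define l where "l = (\<Sum>n. sc (\<phi> (b n)) (a n))"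
  have l: "(\<lambda>n. sc (\<phi> (b n)) (a n)) sums l"
    using assms \<phi> unfolding l_def boundedly_complete_def by (blast intro: summable_sums)
  have "\<phi> y = blinfun_apply y l" if y: "y \<in> dual_space sc" for y
  proof (rule ccontr)
    assume "\<phi> y \<noteq> blinfun_apply y l"
    \<comment> \<open>Truncation and tail each contribute at most one third of the supposed
      distance, which is a contradiction.\<close>
    define \<epsilon> where "\<epsilon> = norm (\<phi> y - blinfun_apply y l) / 3"
    have \<epsilon>: "\<epsilon> > 0"
      using \<open>\<phi> y \<noteq> blinfun_apply y l\<close> by (simp add: \<epsilon>_def)
    have "(\<lambda>n. \<phi> (b n) * blinfun_apply y (a n)) sums blinfun_apply y l"
      using bounded_linear.sums[OF blinfun.bounded_linear_right l, of y] by (simp add: dual_sc[OF y])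
    then obtain N0 where N0: "\<And>N. N \<ge> N0 \<Longrightarrow> norm ((\<Sum>n<N. \<phi> (b n) * blinfun_apply y (a n)) - blinfun_apply y l) < \<epsilon>"
      using \<epsilon> unfolding sums_def LIMSEQ_iff by blast
    obtain N where N: "N \<ge> N0" "\<And>k. k \<ge> N \<Longrightarrow> norm (blinfun_apply y (x k) -
        (\<Sum>n<N. blinfun_apply (b n) (x k) * blinfun_apply y (a n))) \<le> \<epsilon>"
      using weakly_Cauchy_tails[OF conv y \<epsilon> C] by blast
    have "(\<lambda>k. norm (blinfun_apply y (x k) - (\<Sum>n<N. blinfun_apply (b n) (x k) * blinfun_apply y (a n))))
        \<longlonglongrightarrow> norm (\<phi> y - (\<Sum>n<N. \<phi> (b n) * blinfun_apply y (a n)))"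
      by (intro tendsto_intros lim y b_dual)
    then have "norm (\<phi> y - (\<Sum>n<N. \<phi> (b n) * blinfun_apply y (a n))) \<le> \<epsilon>"
      using N(2) by (intro LIMSEQ_le_const2) auto
    then have "norm (\<phi> y - blinfun_apply y l) \<le> 2 * \<epsilon>"
      using N0[OF N(1)] norm_diff_triangle_ineq[of "\<phi> y" "\<Sum>n<N. \<phi> (b n) * blinfun_apply y (a n)"
        "\<Sum>n<N. \<phi> (b n) * blinfun_apply y (a n)" "blinfun_apply y l"]
        norm_triangle_ineq[of "\<phi> y - (\<Sum>n<N. \<phi> (b n) * blinfun_apply y (a n))"
        "(\<Sum>n<N. \<phi> (b n) * blinfun_apply y (a n)) - blinfun_apply y l"]
      by simp
    then show False
      using \<epsilon> by (simp add: \<epsilon>_def)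
  qed
  then show "\<exists>l. \<forall>y\<in>dual_space sc. (\<lambda>n. blinfun_apply y (x n)) \<longlonglongrightarrow> blinfun_apply y l"
    using lim by metis
qed

section \<open>Reflexivity and exclusion of copies\<close>

lemma reflexive_imp_weakly_sequentially_complete:
  assumes "reflexive_space sc"
  shows "weakly_sequentially_complete sc"
  unfolding weakly_sequentially_complete_def
proof (intro allI impI)
  fix x :: "nat \<Rightarrow> 'e"
  assume *: "\<forall>y\<in>dual_space sc. convergent (\<lambda>n. blinfun_apply y (x n))"
  then have "(\<lambda>y. lim (\<lambda>k. blinfun_apply y (x k))) \<in> continuous_functionals dual_scale (dual_space sc)"
    using weakly_Cauchy_limit[of x] by blast
  then obtain l where "\<forall>y\<in>dual_space sc. lim (\<lambda>k. blinfun_apply y (x k)) = blinfun_apply y l"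
    using assms by (auto simp: reflexive_space_def canonical_embedding_def dest: bspec)
  then show "\<exists>l. \<forall>y\<in>dual_space sc. (\<lambda>n. blinfun_apply y (x n)) \<longlonglongrightarrow> blinfun_apply y l"
    using * by (metis convergent_LIMSEQ_iff)
qed

text \<open>Applying \<open>\<phi>\<close> to the norm-convergent expansion of \<open>y\<close> in
  the dual, and \<open>y\<close> to the convergent series defining \<open>l\<close>, produces the
  same scalar series, so \<open>\<phi> y\<close> is the value of \<open>y\<close> at
  \<open>l\<close>.\<close>

lemma reflexive_if_shrinking_boundedly_complete:
  assumes "shrinking sc a b" "boundedly_complete sc a b"
  shows "reflexive_space sc"
  unfolding reflexive_space_def
proof
  fix \<phi> :: "('e \<Rightarrow>\<^sub>L 'k) \<Rightarrow> 'k"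
  assume \<phi>: "\<phi> \<in> continuous_functionals dual_scale (dual_space sc)"
  define l where "l = (\<Sum>n. sc (\<phi> (b n)) (a n))"
  have l: "(\<lambda>n. sc (\<phi> (b n)) (a n)) sums l"
    using assms(2) \<phi> unfolding l_def boundedly_complete_def by (blast intro: summable_sums)
  obtain K where K: "\<And>f. f \<in> dual_space sc \<Longrightarrow> norm (\<phi> f) \<le> K * norm f"
    using \<phi> unfolding continuous_functionals_def by blast
  have "\<phi> y = blinfun_apply y l" if y: "y \<in> dual_space sc" for y
  proof -
    define p where "p = (\<lambda>N. \<Sum>n<N. dual_scale (blinfun_apply y (a n)) (b n))"
    have p: "p \<longlonglongrightarrow> y"
      using assms(1) y unfolding shrinking_def schauder_frame_def canonical_embedding_def sums_def p_def by blast
    have p_dual: "p N \<in> dual_space sc" for N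
      unfolding p_def by (intro dual_space_sum dual_space_scale b_dual)
    have diff: "\<phi> y - \<phi> (p N) = \<phi> (y - p N)" "y - p N \<in> dual_space sc" for N
    proof -
      show yp: "y - p N \<in> dual_space sc"
        using dual_space_add[OF y dual_space_scaleR[OF p_dual, of "- 1"]] by simp
      have "\<phi> (y - p N + p N) = \<phi> (y - p N) + \<phi> (p N)"
        using \<phi> yp p_dual[of N] unfolding continuous_functionals_def by blast
      then show "\<phi> y - \<phi> (p N) = \<phi> (y - p N)"
        by simp
    qed
    have "(\<lambda>N. K * norm (y - p N)) \<longlonglongrightarrow> K * norm (y - y)"
      by (intro tendsto_intros p)
    then have "(\<lambda>N. K * norm (y - p N)) \<longlonglongrightarrow> 0"
      by simp
    moreover have "norm (\<phi> y - \<phi> (p N)) \<le> K * norm (y - p N)" for N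
      unfolding diff(1) by (rule K[OF diff(2)])
    ultimately have "(\<lambda>N. \<phi> y - \<phi> (p N)) \<longlonglongrightarrow> 0"
      by (metis (no_types, lifting) Lim_null_comparison always_eventually)
    then have "(\<lambda>N. \<phi> (p N)) \<longlonglongrightarrow> \<phi> y"
      using tendsto_diff[OF tendsto_const[of "\<phi> y"], of "\<lambda>N. \<phi> y - \<phi> (p N)" 0] by simp
    moreover have "\<phi> (p N) = (\<Sum>n<N. \<phi> (b n) * blinfun_apply y (a n))" for N
      unfolding p_def using functional_dual_sum[OF \<phi>, of "{..<N}" b] b_dual by (simp add: mult.commute)
    moreover have "(\<lambda>n. \<phi> (b n) * blinfun_apply y (a n)) sums blinfun_apply y l"
      using bounded_linear.sums[OF blinfun.bounded_linear_right l, of y] by (simp add: dual_sc[OF y])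
    ultimately show ?thesis
      by (simp add: sums_def LIMSEQ_unique)
  qed
  then show "\<exists>x. \<forall>f\<in>dual_space sc. \<phi> f = canonical_embedding x f"
    by (auto simp: canonical_embedding_def)
qed

text \<open>The partial sums of the unit vectors of the copy form a weakly Cauchy sequence. A weak
  limit would have all coordinates equal to 1 and would be close to some \<open>T s\<close>,
  although \<open>s\<close> tends to 0.\<close>

lemma weakly_sequentially_complete_imp_no_c0:
  assumes wsc: "weakly_sequentially_complete sc"
  shows "\<not> has_subspace_isomorphic_to sc c0_space sup_norm"
proof
  assume "has_subspace_isomorphic_to sc c0_space sup_norm"
  then obtain M T C D where M: "subspace M" and T_bij: "bij_betw T c0_space M"
    and T: "\<And>s t. s \<in> c0_space \<Longrightarrow> t \<in> c0_space \<Longrightarrow> T (\<lambda>n. s n + t n) = T s + T t"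
      "\<And>c s. s \<in> c0_space \<Longrightarrow> T (\<lambda>n. c * s n) = sc c (T s)"
    and C: "\<And>s. s \<in> c0_space \<Longrightarrow> norm (T s) \<le> C * sup_norm s"
    and D: "\<And>s. s \<in> c0_space \<Longrightarrow> sup_norm s \<le> D * norm (T s)"
    unfolding has_subspace_isomorphic_to_def by blast
  define e where "e = (\<lambda>k n::nat. if n = k then 1 else 0 :: 'k)"
  have fin: "(\<lambda>n. if n \<in> F then \<theta> n else 0) \<in> c0_space \<and>
      T (\<lambda>n. if n \<in> F then \<theta> n else 0) = (\<Sum>k\<in>F. sc (\<theta> k) (T (e k)))" if "finite F" for F \<theta>
    unfolding e_def using normed_space_over_axioms T that by (rule c0_finite_support)
  have e: "e k \<in> c0_space" for k
    using fin[of "{k}" "\<lambda>_. 1", THEN conjunct1] by (simp add: e_def)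
  have T_M: "T s \<in> M" if "s \<in> c0_space" for s
    using T_bij that by (auto simp: bij_betw_def)
  define x where "x = (\<lambda>n. \<Sum>k<n. T (e k))"
  have x_M: "x n \<in> M" for n
    unfolding x_def using M by (intro subspace_sum) (auto intro: T_M e)
  have "convergent (\<lambda>n. blinfun_apply y (x n))" if y: "y \<in> dual_space sc" for y
  proof -
    have "(\<Sum>k<n. norm (blinfun_apply y (T (e k)))) \<le> norm y * \<bar>C\<bar>" for n
    proof -
      obtain \<theta> where \<theta>: "\<And>k. norm (\<theta> k) = 1"
        "\<And>k. \<theta> k * blinfun_apply y (T (e k)) = of_real (norm (blinfun_apply y (T (e k))))"
        using real_or_complex_phases[of "\<lambda>k. blinfun_apply y (T (e k))"] by blast
      define s where "s = (\<lambda>k. if k \<in> {..<n} then \<theta> k else 0)"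
      have s: "s \<in> c0_space" "T s = (\<Sum>k<n. sc (\<theta> k) (T (e k)))"
        using fin[of "{..<n}" \<theta>] by (simp_all add: s_def)
      have "sup_norm s \<le> 1"
        by (rule sup_norm_le) (simp add: s_def \<theta>)
      moreover have "0 \<le> sup_norm s"
        using norm_le_sup_norm[OF s(1), of 0] norm_ge_zero order_trans by blast
      ultimately have "C * sup_norm s \<le> \<bar>C\<bar> * 1"
        by (intro mult_mono) auto
      then have "norm (T s) \<le> \<bar>C\<bar>"
        using C[OF s(1)] by simp
      have "of_real (\<Sum>k<n. norm (blinfun_apply y (T (e k)))) = blinfun_apply y (T s)"
        by (simp add: s(2) dual_sum_sc[OF y] \<theta>)
      then have "(\<Sum>k<n. norm (blinfun_apply y (T (e k)))) = norm (blinfun_apply y (T s))"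
        by (simp only: norm_of_real abs_of_nonneg sum_nonneg norm_ge_zero flip: \<open>of_real _ = _\<close>)
      also have "\<dots> \<le> norm y * norm (T s)"
        by (rule norm_blinfun)
      also have "\<dots> \<le> norm y * \<bar>C\<bar>"
        using \<open>norm (T s) \<le> \<bar>C\<bar>\<close> by (rule mult_left_mono) simp
      finally show ?thesis .
    qed
    then have "summable (\<lambda>k. norm (blinfun_apply y (T (e k))))"
      by (intro summableI_nonneg_bounded) auto
    from summable_LIMSEQ[OF summable_norm_cancel[OF this]] show ?thesis
      by (auto simp: x_def blinfun.sum_right convergent_def)
  qed
  then obtain l where l: "\<And>y. y \<in> dual_space sc \<Longrightarrow> (\<lambda>n. blinfun_apply y (x n)) \<longlonglongrightarrow> blinfun_apply y l"
    using wsc unfolding weakly_sequentially_complete_def by blast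
  \<comment> \<open>Chosen so that a coordinate functional of norm at most
    \<open>\<bar>D\<bar>\<close> moves by at most 1/2 over the distance \<open>d\<close>; the added
    1 keeps the denominator positive.\<close>
  define d where "d = 1 / (2 * (\<bar>D\<bar> + 1))"
  have d: "d > 0"
    by (simp add: d_def)
  \<comment> \<open>A weak limit of elements of a subspace lies in its norm closure. Closeness to
    one element of \<open>M\<close> is enough, so \<open>l\<close> itself need not be placed in
    \<open>M\<close>.\<close>
  have "\<exists>w\<in>M. norm (l - w) < d"
  proof (rule ccontr)
    assume "\<not> ?thesis"
    then have "\<And>w. w \<in> M \<Longrightarrow> d \<le> norm (l - w)"
      by (meson not_less)
    then obtain f where f: "f \<in> dual_space sc" "\<And>w. w \<in> M \<Longrightarrow> blinfun_apply f w = 0"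
      "blinfun_apply f l = 1"
      using hahn_banach_separation[OF M d] by blast
    then show False
      using l[OF f(1)] by (simp add: f(2)[OF x_M] LIMSEQ_const_iff)
  qed
  then obtain s where s: "s \<in> c0_space" "norm (l - T s) < d"
    using T_bij by (auto simp: bij_betw_def)
  have inv: "inv_into c0_space T (T t) = t" if "t \<in> c0_space" for t
    using T_bij that by (auto simp: bij_betw_def)
  have "norm (1 - s k) \<le> 1 / 2" for k
  proof -
    \<comment> \<open>The \<open>k\<close>-th coordinate of the copy. It is bounded by the lower
      estimate of \<open>T\<close> and is extended to the whole space so that it can be applied to
      \<open>l\<close>.\<close>
    define F where "F = (\<lambda>m. inv_into c0_space T m k)"
    have F_T: "F (T t) = t k" if "t \<in> c0_space" for t
      using inv[OF that] by (simp add: F_def)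
    have F_le: "norm (F m) \<le> \<bar>D\<bar> * norm m" if "m \<in> M" for m
    proof -
      obtain t where t: "t \<in> c0_space" "m = T t"
        using \<open>m \<in> M\<close> T_bij by (auto simp: bij_betw_def)
      have "norm (t k) \<le> sup_norm t"
        using t(1) by (rule norm_le_sup_norm)
      also have "\<dots> \<le> D * norm (T t)"
        using t(1) by (rule D)
      also have "\<dots> \<le> \<bar>D\<bar> * norm (T t)"
        by (rule mult_right_mono) auto
      finally show ?thesis
        by (simp add: t F_T)
    qed
    have F_add: "F (m + m') = F m + F m'" if "m \<in> M" "m' \<in> M" for m m'
      using that T_bij by (auto simp: c0_space_add bij_betw_def F_T T(1)[symmetric])
    have F_scale: "F (sc c m) = c * F m" if "m \<in> M" for c m
      using that T_bij by (auto simp: c0_space_mult bij_betw_def F_T T(2)[symmetric])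
    obtain f where f: "f \<in> dual_space sc" "\<And>m. m \<in> M \<Longrightarrow> blinfun_apply f m = F m"
      "norm f \<le> \<bar>D\<bar>"
      using hahn_banach_extension[OF M abs_ge_zero F_add F_scale F_le] by blast
    have "blinfun_apply f (x n) = 1" if "n > k" for n
    proof -
      have "blinfun_apply f (x n) = (\<Sum>j<n. e j k)"
        by (simp add: x_def blinfun.sum_right f(2) T_M e F_T)
      then show ?thesis
        using that by (simp add: e_def)
    qed
    then have "(\<lambda>n. blinfun_apply f (x n)) \<longlonglongrightarrow> 1"
      by (intro tendsto_eventually eventually_sequentiallyI[of "Suc k"]) auto
    then have "blinfun_apply f l = 1"
      using l[OF f(1)] LIMSEQ_unique by blast
    then have "1 - s k = blinfun_apply f (l - T s)"
      using s(1) by (simp add: blinfun.diff_right f(2) T_M F_T)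
    also have "norm \<dots> \<le> norm f * norm (l - T s)"
      by (rule norm_blinfun)
    also have "\<dots> \<le> \<bar>D\<bar> * d"
      using f(3) s(2) by (intro mult_mono) auto
    also have "\<dots> \<le> 1 / 2"
      by (simp add: d_def field_simps)
    finally show ?thesis .
  qed
  moreover have "(\<lambda>k. norm (1 - s k)) \<longlonglongrightarrow> norm (1 - 0 :: 'k)"
    using s(1) by (intro tendsto_intros) (simp add: c0_space_def)
  ultimately have "norm (1 - 0 :: 'k) \<le> 1 / 2"
    by (intro LIMSEQ_le_const2) auto
  then show False
    by simp
qed

text \<open>If the span of the \<open>b\<^sub>n\<close> is dense in the dual, a diagonal argument shows that every bounded sequence has a
  weakly Cauchy subsequence, which the unit vectors of \<open>\<ell>\<^sub>1\<close> do not have.\<close>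

lemma no_l1_if_dense:
  assumes dense: "\<And>y \<epsilon>. y \<in> dual_space sc \<Longrightarrow> \<epsilon> > 0 \<Longrightarrow>
    \<exists>N c. norm (y - (\<Sum>n<N. dual_scale (c n) (b n))) < \<epsilon>"
  shows "\<not> has_subspace_isomorphic_to sc l1_space l1_norm"
proof
  assume "has_subspace_isomorphic_to sc l1_space l1_norm"
  then obtain M T C D where M: "subspace M" and T_bij: "bij_betw T l1_space M"
    and T: "\<And>s t. s \<in> l1_space \<Longrightarrow> t \<in> l1_space \<Longrightarrow> T (\<lambda>n. s n + t n) = T s + T t"
      "\<And>c s. s \<in> l1_space \<Longrightarrow> T (\<lambda>n. c * s n) = sc c (T s)"
    and C: "\<And>s. s \<in> l1_space \<Longrightarrow> norm (T s) \<le> C * l1_norm s"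
    and D: "\<And>s. s \<in> l1_space \<Longrightarrow> l1_norm s \<le> D * norm (T s)"
    unfolding has_subspace_isomorphic_to_def by blast
  define e where "e = (\<lambda>k n::nat. if n = k then 1 else 0 :: 'k)"
  have e_sums: "(\<lambda>n. norm (e k n)) sums 1" for k
    using sums_single[of k "\<lambda>_. 1::real"] by (simp add: e_def if_distrib[of norm] cong: if_cong)
  have e: "e k \<in> l1_space" "l1_norm (e k) = 1" for k
    using e_sums[of k] by (auto simp: l1_space_def l1_norm_def sums_iff)
  have T_M: "T s \<in> M" if "s \<in> l1_space" for s
    using T_bij that by (auto simp: bij_betw_def)
  define x where "x = (\<lambda>k. T (e k))"
  have x_le: "norm (x k) \<le> C" for k
    using C[OF e(1), of k] by (simp add: x_def e(2))
  have C0: "0 \<le> C"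
    using x_le[of 0] norm_ge_zero order_trans by blast
  \<comment> \<open>Division by \<open>norm (b m) + 1\<close> makes the bound independent of
    \<open>m\<close>, as the diagonal subsequence argument requires; multiplying back preserves
    convergence.\<close>
  have bd: "norm (blinfun_apply (b m) (x n) /\<^sub>R (norm (b m) + 1)) \<le> C" for n m
  proof -
    have "norm (blinfun_apply (b m) (x n)) \<le> norm (b m) * C"
      using norm_blinfun[of "b m" "x n"] mult_left_mono[OF x_le[of n], of "norm (b m)"] by simp
    also have "\<dots> \<le> (norm (b m) + 1) * C"
      using C0 by (intro mult_right_mono) auto
    finally have "norm (blinfun_apply (b m) (x n)) \<le> (norm (b m) + 1) * C" .
    moreover have "norm (b m) + 1 > 0"
      using norm_ge_zero[of "b m"] by linarith
    ultimately show ?thesis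
      by (simp add: field_simps)
  qed
  obtain r where r: "strict_mono (r :: nat \<Rightarrow> nat)"
    "\<And>m. \<exists>l. (\<lambda>n. blinfun_apply (b m) (x (r n)) /\<^sub>R (norm (b m) + 1)) \<longlonglongrightarrow> l"
    by (rule function_convergent_subsequence[OF countableI_type[of UNIV],
          where f = "\<lambda>n m. blinfun_apply (b m) (x n) /\<^sub>R (norm (b m) + 1)", OF bd])
      (rule that, assumption, blast)
  have b_conv: "convergent (\<lambda>n. blinfun_apply (b m) (x (r n)))" for m
  proof -
    obtain l where l: "(\<lambda>n. blinfun_apply (b m) (x (r n)) /\<^sub>R (norm (b m) + 1)) \<longlonglongrightarrow> l"
      using r(2) by blast
    have "norm (b m) + 1 > 0"
      using norm_ge_zero[of "b m"] by linarith
    then have "(\<lambda>n. blinfun_apply (b m) (x (r n))) \<longlonglongrightarrow> (norm (b m) + 1) *\<^sub>R l"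
      using tendsto_scaleR[OF tendsto_const[of "norm (b m) + 1"] l] by simp
    then show ?thesis
      by (auto simp: convergent_def)
  qed
  have Cauchy: "Cauchy (\<lambda>n. blinfun_apply y (x (r n)))" if y: "y \<in> dual_space sc" for y
  proof (rule metric_CauchyI)
    fix \<epsilon> :: real assume \<epsilon>: "\<epsilon> > 0"
    \<comment> \<open>Three-epsilon argument: two of the three parts come from replacing
      \<open>y\<close> by \<open>g\<close> on vectors of norm at most \<open>C\<close>.\<close>
    define \<eta> where "\<eta> = \<epsilon> / (3 * (C + 1))"
    have \<eta>: "\<eta> > 0" "\<eta> * C < \<epsilon> / 3"
      using \<epsilon> C0 by (auto simp: \<eta>_def field_simps)
    obtain N c where Nc: "norm (y - (\<Sum>n<N. dual_scale (c n) (b n))) < \<eta>"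
      using dense[OF y \<eta>(1)] by blast
    define g where "g = (\<Sum>n<N. dual_scale (c n) (b n))"
    have "convergent (\<lambda>n. blinfun_apply g (x (r n)))"
    proof -
      have "(\<lambda>n. blinfun_apply (b m) (x (r n))) \<longlonglongrightarrow> lim (\<lambda>n. blinfun_apply (b m) (x (r n)))" for m
        using b_conv by (simp add: convergent_LIMSEQ_iff)
      then have "(\<lambda>n. \<Sum>m<N. c m * blinfun_apply (b m) (x (r n))) \<longlonglongrightarrow>
          (\<Sum>m<N. c m * lim (\<lambda>n. blinfun_apply (b m) (x (r n))))"
        by (intro tendsto_intros)
      then show ?thesis
        by (auto simp: g_def blinfun.sum_left convergent_def)
    qed
    then obtain K where K: "\<And>p q. p \<ge> K \<Longrightarrow> q \<ge> K \<Longrightarrow>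
        dist (blinfun_apply g (x (r p))) (blinfun_apply g (x (r q))) < \<epsilon> / 3"
      using \<epsilon> metric_CauchyD[OF convergent_Cauchy, of _ "\<epsilon> / 3"] by (metis divide_pos_pos zero_less_numeral)
    have close: "dist (blinfun_apply y (x n)) (blinfun_apply g (x n)) < \<epsilon> / 3" for n
    proof -
      have "dist (blinfun_apply y (x n)) (blinfun_apply g (x n)) \<le> norm (y - g) * norm (x n)"
        using norm_blinfun[of "y - g" "x n"] by (simp add: dist_norm blinfun.diff_left)
      also have "\<dots> \<le> \<eta> * C"
        using Nc x_le[of n] \<eta>(1) by (intro mult_mono) (auto simp: g_def)
      also have "\<dots> < \<epsilon> / 3"
        by (rule \<eta>)
      finally show ?thesis .
    qed
    have "dist (blinfun_apply y (x (r p))) (blinfun_apply y (x (r q))) < \<epsilon>" if "p \<ge> K" "q \<ge> K" for p q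
      using K[OF that] close[of "r p"] close[of "r q"]
        dist_triangle[of "blinfun_apply y (x (r p))" "blinfun_apply y (x (r q))" "blinfun_apply g (x (r p))"]
        dist_triangle[of "blinfun_apply g (x (r p))" "blinfun_apply y (x (r q))" "blinfun_apply g (x (r q))"]
        dist_commute[of "blinfun_apply y (x (r q))" "blinfun_apply g (x (r q))"]
      by linarith
    then show "\<exists>M. \<forall>m\<ge>M. \<forall>n\<ge>M. dist (blinfun_apply y (x (r m))) (blinfun_apply y (x (r n))) < \<epsilon>"
      by blast
  qed
  \<comment> \<open>A bounded sequence acts as a functional on \<open>l_1\<close>. This one takes
    the values 1 and 0 alternately along the chosen subsequence, so its extension cannot converge
    there.\<close>
  define \<sigma> where "\<sigma> = (\<lambda>n. if n \<in> range (\<lambda>i. r (2 * i)) then 1 else 0 :: 'k)"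
  have \<sigma>_even: "\<sigma> (r (2 * i)) = 1" for i
    by (auto simp: \<sigma>_def)
  have \<sigma>_odd: "\<sigma> (r (2 * i + 1)) = 0" for i
    using strict_mono_eq[OF r(1)] by (auto simp: \<sigma>_def) presburger
  define F where "F = (\<lambda>m. \<Sum>n. \<sigma> n * inv_into l1_space T m n)"
  have F_T: "F (T t) = (\<Sum>n. \<sigma> n * t n)" if "t \<in> l1_space" for t
    using T_bij that by (simp add: F_def bij_betw_def)
  have n_summ: "summable (\<lambda>n. norm (\<sigma> n * t n))" if "t \<in> l1_space" for t
    by (rule summable_comparison_test'[of "\<lambda>n. norm (t n)" 0]) (use that in \<open>auto simp: l1_space_def \<sigma>_def\<close>)
  note summ = summable_norm_cancel[OF n_summ]
  have F_le: "norm (F m) \<le> \<bar>D\<bar> * norm m" if "m \<in> M" for m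
  proof -
    obtain t where t: "t \<in> l1_space" "m = T t"
      using \<open>m \<in> M\<close> T_bij by (auto simp: bij_betw_def)
    have "norm (F m) \<le> (\<Sum>n. norm (\<sigma> n * t n))"
      unfolding t(2) F_T[OF t(1)] by (rule summable_norm[OF n_summ[OF t(1)]])
    also have "\<dots> \<le> l1_norm t"
      unfolding l1_norm_def
      by (rule suminf_le[OF _ n_summ[OF t(1)]]) (use t(1) in \<open>auto simp: l1_space_def \<sigma>_def\<close>)
    also have "\<dots> \<le> D * norm m"
      using D[OF t(1)] by (simp add: t(2))
    also have "\<dots> \<le> \<bar>D\<bar> * norm m"
      by (rule mult_right_mono) auto
    finally show ?thesis .
  qed
  have F_add: "F (m + m') = F m + F m'" if "m \<in> M" "m' \<in> M" for m m'
  proof -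
    obtain s t where st: "s \<in> l1_space" "m = T s" "t \<in> l1_space" "m' = T t"
      using \<open>m \<in> M\<close> \<open>m' \<in> M\<close> T_bij unfolding bij_betw_def by blast
    have "F (m + m') = (\<Sum>n. \<sigma> n * s n + \<sigma> n * t n)"
      by (simp add: st T(1)[symmetric] F_T l1_space_add distrib_left)
    also have "\<dots> = F m + F m'"
      by (simp add: st F_T suminf_add summ)
    finally show ?thesis .
  qed
  have F_scale: "F (sc c m) = c * F m" if "m \<in> M" for c m
  proof -
    obtain t where t: "t \<in> l1_space" "m = T t"
      using \<open>m \<in> M\<close> T_bij by (auto simp: bij_betw_def)
    have "F (sc c m) = (\<Sum>n. c * (\<sigma> n * t n))"
      by (simp add: t T(2)[symmetric] F_T l1_space_mult mult.left_commute)
    also have "\<dots> = c * F m"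
      using suminf_mult[OF summ[OF t(1)], of c] by (simp add: t F_T)
    finally show ?thesis .
  qed
  obtain f where f: "f \<in> dual_space sc" "\<And>m. m \<in> M \<Longrightarrow> blinfun_apply f m = F m"
    using hahn_banach_extension[OF M abs_ge_zero F_add F_scale F_le] by blast
  have f_x: "blinfun_apply f (x k) = \<sigma> k" for k
  proof -
    have "(\<lambda>n. \<sigma> n * e k n) sums \<sigma> k"
      using sums_single[of k \<sigma>] by (simp add: e_def if_distrib[of "(*) _"] cong: if_cong)
    then show ?thesis
      by (simp add: x_def f(2)[OF T_M[OF e(1)]] F_T[OF e(1)] sums_iff)
  qed
  obtain L where L: "(\<lambda>n. blinfun_apply f (x (r n))) \<longlonglongrightarrow> L"
    using Cauchy[OF f(1)] by (auto simp: Cauchy_convergent_iff convergent_def)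
  have "strict_mono (\<lambda>i::nat. 2 * i)" "strict_mono (\<lambda>i::nat. 2 * i + 1)"
    by (auto simp: strict_mono_def)
  from LIMSEQ_subseq_LIMSEQ[OF L this(1)] LIMSEQ_subseq_LIMSEQ[OF L this(2)]
  have "L = 1" "L = 0"
    by (auto simp: o_def f_x \<sigma>_even \<sigma>_odd[simplified] LIMSEQ_const_iff)
  then show False
    by simp
qed

lemma shrinking_imp_no_l1:
  assumes "shrinking sc a b"
  shows "\<not> has_subspace_isomorphic_to sc l1_space l1_norm"
proof (rule no_l1_if_dense)
  fix y and \<epsilon> :: real
  assume y: "y \<in> dual_space sc" and \<epsilon>: "\<epsilon> > 0"
  have "(\<lambda>N. \<Sum>n<N. dual_scale (blinfun_apply y (a n)) (b n)) \<longlonglongrightarrow> y"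
    using assms y unfolding shrinking_def schauder_frame_def canonical_embedding_def sums_def by blast
  then obtain N where "norm ((\<Sum>n<N. dual_scale (blinfun_apply y (a n)) (b n)) - y) < \<epsilon>"
    using \<epsilon> by (meson LIMSEQ_iff order_refl)
  then show "\<exists>N c. norm (y - (\<Sum>n<N. dual_scale (c n) (b n))) < \<epsilon>"
    by (metis norm_minus_commute)
qed

text \<open>If the span of the \<open>b n\<close> were not dense, a functional on the dual would
  vanish on it without vanishing at some \<open>y\<close>. Reflexivity represents this functional by
  a vector \<open>x\<close> annihilated by every \<open>b n\<close>, and the frame expansion forces
  \<open>x = 0\<close>.\<close>

lemma reflexive_imp_no_l1:
  assumes "reflexive_space sc"
  shows "\<not> has_subspace_isomorphic_to sc l1_space l1_norm"
proof (rule no_l1_if_dense)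
  interpret dual: normed_space_over "dual_scale :: 'k \<Rightarrow> ('e \<Rightarrow>\<^sub>L 'k) \<Rightarrow> ('e \<Rightarrow>\<^sub>L 'k)"
    by (rule normed_space_over_dual_scale)
  fix y and \<epsilon> :: real
  assume y: "y \<in> dual_space sc" and \<epsilon>: "\<epsilon> > 0"
  \<comment> \<open>The span is written with initial segments of indices, the form in which density
    is required; sums of different lengths are padded with zero coefficients.\<close>
  define W where "W = {\<Sum>n<N. dual_scale (c n) (b n) |N c. True}"
  have W_I: "(\<Sum>n<N. dual_scale (c n) (b n)) \<in> W" for N c
    by (auto simp: W_def)
  have W: "dual.subspace W"
  proof (rule dual.subspaceI)
    show "0 \<in> W"
      using W_I[where N = 0] by simp
  next
    fix f g assume "f \<in> W" "g \<in> W"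
    then obtain N c N' c' where f: "f = (\<Sum>n<N. dual_scale (c n) (b n))"
      and g: "g = (\<Sum>n<N'. dual_scale (c' n) (b n))"
      by (auto simp: W_def)
    have pad: "(\<Sum>n<K. dual_scale (u n) (b n)) = (\<Sum>n<max N N'. dual_scale (if n < K then u n else 0) (b n))"
      if "K \<le> max N N'" for K u
      by (rule sum.mono_neutral_cong_left) (use that in auto)
    have "f + g = (\<Sum>n<max N N'. dual_scale ((if n < N then c n else 0) + (if n < N' then c' n else 0)) (b n))"
      by (simp only: f g pad[of N c] pad[of N' c'] max.cobounded1 max.cobounded2
          sum.distrib[symmetric] dual.scale_left_distrib)
    then show "f + g \<in> W"
      by (simp only: W_I)
  next
    fix c f assume "f \<in> W"
    then obtain N u where "f = (\<Sum>n<N. dual_scale (u n) (b n))"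
      by (auto simp: W_def)
    then have "dual_scale c f = (\<Sum>n<N. dual_scale (c * u n) (b n))"
      by (simp add: dual.scale_sum_right)
    then show "dual_scale c f \<in> W"
      by (simp only: W_I)
  qed
  have b_W: "b n \<in> W" for n
  proof -
    have "(\<Sum>i<Suc n. dual_scale (if i = n then 1 else 0) (b i)) = b n"
      by simp
    then show ?thesis
      using W_I[of "\<lambda>i. if i = n then 1 else 0" "Suc n"] by (simp only:)
  qed
  have "\<exists>w\<in>W. norm (y - w) < \<epsilon>"
  proof (rule ccontr)
    assume "\<not> ?thesis"
    then have "\<And>w. w \<in> W \<Longrightarrow> \<epsilon> \<le> norm (y - w)"
      by (meson not_less)
    then obtain \<Phi> where \<Phi>: "\<Phi> \<in> dual_space dual_scale" "\<And>w. w \<in> W \<Longrightarrow> blinfun_apply \<Phi> w = 0"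
      "blinfun_apply \<Phi> y = 1"
      using dual.hahn_banach_separation[OF W \<epsilon>] by blast
    \<comment> \<open>Separation took place in the full space of real-linear bounded maps; its
      functional is now restricted to \<open>dual_space sc\<close>, where reflexivity
      speaks.\<close>
    have "blinfun_apply \<Phi> \<in> continuous_functionals dual_scale (dual_space sc)"
      using \<Phi>(1) unfolding dual_space_def continuous_functionals_def by blast
    then obtain x where x: "\<And>f. f \<in> dual_space sc \<Longrightarrow> blinfun_apply \<Phi> f = blinfun_apply f x"
      using assms unfolding reflexive_space_def canonical_embedding_def by blast
    have "blinfun_apply (b n) x = 0" for n
      using x[OF b_dual] \<Phi>(2)[OF b_W] by metis
    then have "x = 0"
      using expansion[of x] by (simp add: sums_iff)
    then show False
      using x[OF y] \<Phi>(3) by (simp add: blinfun.zero_right)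
  qed
  then show "\<exists>N c. norm (y - (\<Sum>n<N. dual_scale (c n) (b n))) < \<epsilon>"
    by (auto simp: W_def)
qed

end

theorem theoremA:
  fixes sc :: "'k::real_or_complex \<Rightarrow> 'e::banach \<Rightarrow> 'e"
    and a :: "nat \<Rightarrow> 'e" and b :: "nat \<Rightarrow> 'e \<Rightarrow>\<^sub>L 'k"
  assumes "normed_space_over sc"
    and "besselian_schauder_frame sc a b"
  shows
    "(shrinking sc a b \<longleftrightarrow> \<not> has_subspace_isomorphic_to sc l1_space l1_norm) \<and>
     ((boundedly_complete sc a b \<longleftrightarrow> weakly_sequentially_complete sc) \<and>
      (weakly_sequentially_complete sc \<longleftrightarrow> \<not> has_subspace_isomorphic_to sc c0_space sup_norm)) \<and>
     (reflexive_space sc \<longleftrightarrow>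
        \<not> has_subspace_isomorphic_to sc l1_space l1_norm \<and>
        \<not> has_subspace_isomorphic_to sc c0_space sup_norm)"
proof -
  interpret normed_space_over sc by fact
  obtain B where "besselian_frame sc a b B"
    using assms(2) unfolding besselian_schauder_frame_def besselian_def
    by (auto intro!: besselian_frame.intro besselian_frame_axioms.intro assms(1))
  then interpret besselian_frame sc a b B .
  \<comment> \<open>The second item closes as a cycle of three implications. In the third,
    reflexivity excludes \<open>c_0\<close> through weak sequential completeness and
    \<open>l_1\<close> directly; conversely, absence of both copies makes the frame shrinking and
    boundedly complete.\<close>
  show ?thesis
    using exists_l1_if_not_shrinking shrinking_imp_no_l1
      boundedly_complete_imp_weakly_sequentially_complete weakly_sequentially_complete_imp_no_c0
      exists_c0_if_not_boundedly_complete reflexive_imp_weakly_sequentially_complete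
      reflexive_imp_no_l1 reflexive_if_shrinking_boundedly_complete
    by blast
qed

end
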